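(* For every graph $G$ with $\delta(G) \geq 2$ and for every integer $k \geq 2$, one can construct in polynomial time two orientations $O_1, O_2$ of $G^{(1)}$ such that the following are equivalent: \begin{enumerate} \item[(i)] $\operatorname{dist}_{\mathcal{I}(G^{(1)})}(O_1,O_2) \leq k$, \item[(ii)] $\operatorname{diam}(\mathcal{I}(G^{(1)})) \leq k$, \item[(iii)] $\chi(G) \leq 2^k - 1$. \end{enumerate}
   Context: Graphs are finite and simple; $\delta(G)$ is the minimum degree of $G$ and $\chi(G)$ its chromatic number. $G^{(1)}$ denotes the graph obtained from $G$ by subdividing every edge of $G$ exactly once. In an orientation $\vec{H}$ of a graph $H$, the inversion of a set $X \subseteq V(H)$ consists in reversing all arcs with both endvertices in $X$. The inversion graph $\mathcal{I}(H)$ is the graph whose vertices are the labelled orientations of $H$, two orientations being adjacent if and only if the inversion of some $X\subseteq V(H)$ transforms one into the other; $\operatorname{dist}_{\mathcal{I}(H)}$ is the distance in this graph and $\operatorname{diam}(\mathcal{I}(H))$ its diameter. *)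

theory Defs
  imports
    "HOL-Library.Extended_Nat"
    "HOL-Library.Log_Nat"
    "HOL-Computational_Algebra.Polynomial"
begin

section \<open>Graphs\<close>

datatype 'a graph = Graph (verts: "'a set") (edges: "'a set set")

definition simple_graph :: "'a graph \<Rightarrow> bool" where
  "simple_graph G \<longleftrightarrow> finite (verts G) \<and> (\<forall>e\<in>edges G. e \<subseteq> verts G \<and> card e = 2)"

definition vdegree :: "'a graph \<Rightarrow> 'a \<Rightarrow> nat" where
  "vdegree G v = card {e \<in> edges G. v \<in> e}"

text \<open>The graph without vertices has minimum degree \<open>\<infinity>\<close>; otherwise this is the usual minimum.\<close>

definition min_degree :: "'a graph \<Rightarrow> enat" where
  "min_degree G = (INF v\<in>verts G. enat (vdegree G v))"

definition colourable :: "'a graph \<Rightarrow> nat \<Rightarrow> bool" where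
  "colourable G k \<longleftrightarrow>
    (\<exists>c. (\<forall>v\<in>verts G. c v < k) \<and> (\<forall>u v. {u, v} \<in> edges G \<longrightarrow> c u \<noteq> (c v :: nat)))"

definition chromatic_number :: "'a graph \<Rightarrow> nat" where
  "chromatic_number G = (LEAST k. colourable G k)"

definition walk :: "'a graph \<Rightarrow> 'a list \<Rightarrow> bool" where
  "walk G ws \<longleftrightarrow>
    ws \<noteq> [] \<and> set ws \<subseteq> verts G \<and> successively (\<lambda>u v. {u, v} \<in> edges G) ws"

definition graph_dist :: "'a graph \<Rightarrow> 'a \<Rightarrow> 'a \<Rightarrow> enat" where
  "graph_dist G u v =
    (INF ws\<in>{ws. walk G ws \<and> hd ws = u \<and> last ws = v}. enat (length ws - 1))"

definition graph_diam :: "'a graph \<Rightarrow> enat" where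
  "graph_diam G = (SUP u\<in>verts G. SUP v\<in>verts G. graph_dist G u v)"

text \<open>The vertex subdividing the edge \<open>e\<close> is \<open>Inr e\<close>.\<close>

definition subdivision :: "'a graph \<Rightarrow> ('a + 'a set) graph" where
  "subdivision G =
    Graph (Inl ` verts G \<union> Inr ` edges G) {{Inl v, Inr e} | v e. e \<in> edges G \<and> v \<in> e}"


section \<open>Orientations and inversions\<close>

definition orientation :: "'a graph \<Rightarrow> ('a \<times> 'a) set \<Rightarrow> bool" where
  "orientation H A \<longleftrightarrow>
    (\<forall>(u, v)\<in>A. {u, v} \<in> edges H) \<and>
    (\<forall>u v. {u, v} \<in> edges H \<longrightarrow> ((u, v) \<in> A) \<noteq> ((v, u) \<in> A))"

definition inversion :: "'a set \<Rightarrow> ('a \<times> 'a) set \<Rightarrow> ('a \<times> 'a) set" where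
  "inversion X A =
    {(u, v) \<in> A. \<not> (u \<in> X \<and> v \<in> X)} \<union> {(v, u) | u v. (u, v) \<in> A \<and> u \<in> X \<and> v \<in> X}"

definition inversion_graph :: "'a graph \<Rightarrow> ('a \<times> 'a) set graph" where
  "inversion_graph H =
    Graph {A. orientation H A}
      {{A, B} | A B. orientation H A \<and> orientation H B \<and> A \<noteq> B \<and>
        (\<exists>X\<subseteq>verts H. inversion X A = B)}"


section \<open>Polynomial time\<close>

text \<open>
  The model of computation is a random access machine with structured control flow. A state
  consists of the registers and of the memory, both indexed by natural numbers; only the memory
  can be addressed indirectly. Every instruction and every test costs one time unit. The only
  arithmetic operations are addition and truncated subtraction, so that in \<open>t\<close> steps the binary
  length of the numbers involved grows by at most \<open>O(t)\<close>; polynomial time on this machine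
  (measured in the binary length of the input) is thus polynomial time on a Turing machine.
\<close>

datatype com =
    Const nat nat
  | Add nat nat nat
  | Sub nat nat nat
  | Load nat nat
  | Store nat nat
  | Seq com com
  | IfNZ nat com com
  | WhileNZ nat com

type_synonym ram_state = "(nat \<Rightarrow> nat) \<times> (nat \<Rightarrow> nat)"

text \<open>\<open>exec c s t s'\<close>: started in \<open>s\<close>, program \<open>c\<close> halts in \<open>s'\<close> after exactly \<open>t\<close> steps.\<close>

inductive exec :: "com \<Rightarrow> ram_state \<Rightarrow> nat \<Rightarrow> ram_state \<Rightarrow> bool" where
  Const: "exec (Const r n) (R, M) 1 (R(r := n), M)"
| Add: "exec (Add r a b) (R, M) 1 (R(r := R a + R b), M)"
| Sub: "exec (Sub r a b) (R, M) 1 (R(r := R a - R b), M)"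
| Load: "exec (Load r a) (R, M) 1 (R(r := M (R a)), M)"
| Store: "exec (Store a r) (R, M) 1 (R, M(R a := R r))"
| Seq: "exec c s t s' \<Longrightarrow> exec d s' t' s'' \<Longrightarrow> exec (Seq c d) s (t + t') s''"
| IfTrue: "fst s r \<noteq> 0 \<Longrightarrow> exec c s t s' \<Longrightarrow> exec (IfNZ r c d) s (t + 1) s'"
| IfFalse: "fst s r = 0 \<Longrightarrow> exec d s t s' \<Longrightarrow> exec (IfNZ r c d) s (t + 1) s'"
| WhileFalse: "fst s r = 0 \<Longrightarrow> exec (WhileNZ r c) s 1 s"
| WhileTrue: "fst s r \<noteq> 0 \<Longrightarrow> exec c s t s' \<Longrightarrow> exec (WhileNZ r c) s' t' s'' \<Longrightarrow>
    exec (WhileNZ r c) s (t + t' + 1) s''"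

inductive_cases exec_elims:
  "exec (Const r n) s t s'" "exec (Add r a b) s t s'" "exec (Sub r a b) s t s'"
  "exec (Load r a) s t s'" "exec (Store a r) s t s'" "exec (Seq c d) s t s'"
  "exec (IfNZ r c d) s t s'"

inductive_cases exec_WhileE: "exec (WhileNZ r c) s t s'"

lemma exec_deterministic:
  "exec c s t s' \<Longrightarrow> exec c s u s'' \<Longrightarrow> t = u \<and> s' = s''"
proof (induction arbitrary: u s'' rule: exec.induct)
  case (Seq c s t s1 d t' s2)
  from Seq.prems obtain v s3 v' where
    *: "exec c s v s3" "exec d s3 v' s''" "u = v + v'"
    by (rule exec_elims(6))
  from Seq.IH(1)[OF *(1)] have "t = v" "s1 = s3" by auto
  with Seq.IH(2)[of v' s''] * show ?case by simp
next
  case (IfTrue s r c t s' d)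
  from IfTrue.prems IfTrue.hyps obtain v where "exec c s v s''" "u = v + 1"
    by (elim exec_elims(7)) auto
  with IfTrue.IH[of v s''] show ?case by simp
next
  case (IfFalse s r d t s' c)
  from IfFalse.prems IfFalse.hyps obtain v where "exec d s v s''" "u = v + 1"
    by (elim exec_elims(7)) auto
  with IfFalse.IH[of v s''] show ?case by simp
next
  case (WhileFalse s r c)
  from WhileFalse.prems show ?case
    by (rule exec_WhileE) (use WhileFalse.hyps in simp_all)
next
  case (WhileTrue s r c t s1 t' s2)
  from WhileTrue.prems obtain v s3 v' where
    *: "exec c s v s3" "exec (WhileNZ r c) s3 v' s''" "u = v + v' + 1"
    by (rule exec_WhileE) (use WhileTrue.hyps(1) in simp_all)
  from WhileTrue.IH(1)[OF *(1)] have "t = v" "s1 = s3" by auto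
  with WhileTrue.IH(2)[of v' s''] * show ?case by simp
qed (erule exec_elims(1-5); simp)+

text \<open>
  The input is a list stored at the beginning of the memory, its length being in register 0;
  the output is read off in the same way.
\<close>

definition ram_input :: "nat list \<Rightarrow> ram_state" where
  "ram_input xs = ((\<lambda>_. 0)(0 := length xs), \<lambda>i. if i < length xs then xs ! i else 0)"

definition ram_output :: "ram_state \<Rightarrow> nat list" where
  "ram_output s = map (snd s) [0..<fst s 0]"

definition computes_within :: "com \<Rightarrow> nat list \<Rightarrow> nat \<Rightarrow> nat list \<Rightarrow> bool" where
  "computes_within c xs T ys \<longleftrightarrow> (\<exists>t s. exec c (ram_input xs) t s \<and> t \<le> T \<and> ram_output s = ys)"

text \<open>\<open>floorlog 2 x\<close> is the number of binary digits of \<open>x\<close>; one is added for a separator.\<close>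

definition bit_size :: "nat list \<Rightarrow> nat" where
  "bit_size xs = (\<Sum>x\<leftarrow>xs. floorlog 2 x + 1)"


section \<open>Representation of graphs and orientations by lists of numbers\<close>

text \<open>Relative to a list \<open>vs\<close> of all vertices, the number \<open>i\<close> stands for the vertex \<open>vs ! i\<close>.\<close>

definition edge_list :: "'a list \<Rightarrow> (nat \<times> nat) list \<Rightarrow> 'a set list" where
  "edge_list vs ps = map (\<lambda>(i, j). {vs ! i, vs ! j}) ps"

definition represents_graph :: "'a list \<Rightarrow> (nat \<times> nat) list \<Rightarrow> 'a graph \<Rightarrow> bool" where
  "represents_graph vs ps G \<longleftrightarrow>
    distinct vs \<and> set vs = verts G \<and>
    (\<forall>(i, j)\<in>set ps. i < length vs \<and> j < length vs) \<and>
    distinct (edge_list vs ps) \<and> set (edge_list vs ps) = edges G"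

definition represents_arcs :: "'a list \<Rightarrow> (nat \<times> nat) list \<Rightarrow> ('a \<times> 'a) set \<Rightarrow> bool" where
  "represents_arcs vs qs A \<longleftrightarrow>
    (\<forall>(i, j)\<in>set qs. i < length vs \<and> j < length vs) \<and>
    distinct qs \<and> (\<lambda>(i, j). (vs ! i, vs ! j)) ` set qs = A"

text \<open>
  If \<open>G\<close> has \<open>n\<close> vertices, the subdivision has the vertex \<open>i\<close> of \<open>G\<close> as vertex \<open>i\<close>, and the vertex
  subdividing the \<open>j\<close>-th listed edge as vertex \<open>n + j\<close>.
\<close>

definition subdivision_vertex_list ::
    "'a list \<Rightarrow> (nat \<times> nat) list \<Rightarrow> ('a + 'a set) list" where
  "subdivision_vertex_list vs ps = map Inl vs @ map Inr (edge_list vs ps)"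

definition flatten :: "(nat \<times> nat) list \<Rightarrow> nat list" where
  "flatten ps = concat (map (\<lambda>(i, j). [i, j]) ps)"

definition encode_instance :: "'a list \<Rightarrow> (nat \<times> nat) list \<Rightarrow> nat \<Rightarrow> nat list" where
  "encode_instance vs ps k = length vs # k # flatten ps"

text \<open>
  Two orientations of the same graph have the same number of arcs, so the concatenation of their
  arc lists determines both of them.
\<close>

definition encode_arc_lists :: "(nat \<times> nat) list \<Rightarrow> (nat \<times> nat) list \<Rightarrow> nat list" where
  "encode_arc_lists qs1 qs2 = flatten qs1 @ flatten qs2"

lemma simple_graph_has_representation:
  assumes "simple_graph G"
  shows "\<exists>vs ps. represents_graph vs ps G"
proof -
  have fin: "finite (verts G)" and E: "\<And>e. e \<in> edges G \<Longrightarrow> e \<subseteq> verts G \<and> card e = 2"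
    using assms by (auto simp: simple_graph_def)
  obtain vs where vs: "set vs = verts G" "distinct vs"
    using finite_distinct_list[OF fin] by blast
  have "finite (edges G)"
    by (rule finite_subset[of _ "Pow (verts G)"]) (use E fin in auto)
  then obtain es where es: "set es = edges G" "distinct es"
    using finite_distinct_list by blast
  have "\<forall>e\<in>set es. \<exists>p. fst p < length vs \<and> snd p < length vs \<and> e = {vs ! fst p, vs ! snd p}"
  proof
    fix e assume "e \<in> set es"
    then have "e \<subseteq> set vs" "card e = 2" using E es vs by auto
    then obtain u v where uv: "e = {u, v}" "u \<in> set vs" "v \<in> set vs"
      by (auto simp: card_2_iff)
    then obtain i j where "i < length vs" "j < length vs" "vs ! i = u" "vs ! j = v"
      by (auto simp: in_set_conv_nth)
    with uv show "\<exists>p. fst p < length vs \<and> snd p < length vs \<and> e = {vs ! fst p, vs ! snd p}"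
      by (intro exI[of _ "(i, j)"]) auto
  qed
  then obtain f where f: "\<And>e. e \<in> set es \<Longrightarrow>
      fst (f e) < length vs \<and> snd (f e) < length vs \<and> e = {vs ! fst (f e), vs ! snd (f e)}"
    by metis
  have "edge_list vs (map f es) = map (\<lambda>e. e) es"
    unfolding edge_list_def map_map by (rule map_cong) (use f in \<open>auto simp: split_beta\<close>)
  then have "edge_list vs (map f es) = es" by simp
  then have "represents_graph vs (map f es) G"
    unfolding represents_graph_def using vs es f by (auto simp: split_beta)
  then show ?thesis by blast
qed

end

theory Submission
  imports Defs
begin

text \<open>
  Two orientations of \<open>G\<^sup>(\<^sup>1\<^sup>)\<close> are at distance at most \<open>k\<close> iff vectors in \<open>F\<^sub>2\<^sup>k\<close> can be assigned to the
  vertices such that the two ends of an edge have scalar product \<open>1\<close> exactly if the edge has to be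
  reversed. Once the vertices of \<open>G\<close> have vectors, the vector of a subdividing vertex solves two
  linear equations, which is always possible if the ends of the subdivided edge carry distinct nonzero
  vectors, that is, if the vectors form a colouring of \<open>G\<close> with \<open>2\<^sup>k - 1\<close> colours. Conversely, if
  exactly one half of every subdivided edge has to be reversed, adjacent vertices need distinct
  vectors, and a vertex incident to a half that has to be reversed needs a nonzero one.

  It remains to select one end of every edge so that every vertex is selected. Walk from an
  unmarked vertex, marking each vertex and giving it some incident edge other than the one by which it
  was reached, along which the walk continues until it meets a marked vertex. Minimum degree
  two makes this possible, and no edge is given away twice: an edge already owned by its other end
  leads to a vertex that was marked immediately afterwards.
\<close>

section \<open>Distance in the inversion graph\<close>

text \<open>\<open>enat\<close> is well-ordered, so the infimum of a nonempty family is attained;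
  the empty family has infimum infinity. A finite distance is thus realised by an actual
  walk.\<close>

lemma INF_enat_le_iff: "(INF x\<in>S. enat (f x)) \<le> enat k \<longleftrightarrow> (\<exists>x\<in>S. f x \<le> k)"
proof
  assume *: "(INF x\<in>S. enat (f x)) \<le> enat k"
  then obtain x where "x \<in> S"
    by (cases "S = {}") (auto simp: top_enat_def)
  then have "(INF x\<in>S. enat (f x)) \<in> (\<lambda>x. enat (f x)) ` S"
    by (intro wellorder_InfI) blast
  with * show "\<exists>x\<in>S. f x \<le> k" by auto
next
  assume "\<exists>x\<in>S. f x \<le> k"
  then show "(INF x\<in>S. enat (f x)) \<le> enat k"
    by (meson INF_lower2 enat_ord_simps(1))
qed

lemma in_inversion:
  "(u, v) \<in> inversion X A \<longleftrightarrow> (if u \<in> X \<and> v \<in> X then (v, u) \<in> A else (u, v) \<in> A)"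
  by (auto simp: inversion_def)

lemma inversion_involution: "inversion X (inversion X A) = A"
  by (auto simp: in_inversion split: if_splits)

text \<open>Each inverted set containing both ends swaps the arc once, so only the parity of their
  number counts. Indices are counted because \<open>Xs\<close> may repeat a set.\<close>

lemma in_fold_inversion:
  "(u, v) \<in> fold inversion Xs A \<longleftrightarrow>
    (if odd (card {i. i < length Xs \<and> u \<in> Xs ! i \<and> v \<in> Xs ! i}) then (v, u) \<in> A else (u, v) \<in> A)"
proof -
  have "(u, v) \<in> fold inversion Xs A \<longleftrightarrow>
    (if odd (length (filter (\<lambda>X. u \<in> X \<and> v \<in> X) Xs)) then (v, u) \<in> A else (u, v) \<in> A)"
    by (induction Xs arbitrary: A) (auto simp: in_inversion)
  then show ?thesis by (simp add: length_filter_conv_card)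
qed

lemma orientationD:
  assumes "orientation H A"
  shows "(u, v) \<in> A \<Longrightarrow> {u, v} \<in> edges H"
    and "{u, v} \<in> edges H \<Longrightarrow> (v, u) \<in> A \<longleftrightarrow> (u, v) \<notin> A"
  using assms by (auto simp: orientation_def)

lemma orientation_inversion:
  assumes "orientation H A"
  shows "orientation H (inversion X A)"
proof -
  have "{u, v} \<in> edges H" if "(u, v) \<in> inversion X A" for u v
    using that orientationD(1)[OF assms, of u v] orientationD(1)[OF assms, of v u]
    by (simp only: in_inversion insert_commute[of v u] split: if_splits)
  moreover have "((u, v) \<in> inversion X A) \<noteq> ((v, u) \<in> inversion X A)" if "{u, v} \<in> edges H" for u v
    using orientationD(2)[OF assms that] by (simp add: in_inversion)
  ultimately show ?thesis unfolding orientation_def by blast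
qed

lemma orientation_fold_inversion:
  "orientation H A \<Longrightarrow> orientation H (fold inversion Xs A)"
  by (induction Xs arbitrary: A) (auto intro: orientation_inversion)

text \<open>Edges of the inversion graph come from subsets of the vertex set. Arcs have their ends
  there, so an arbitrary set may be truncated.\<close>

lemma inversion_Int_verts:
  assumes "orientation H A" "\<forall>e\<in>edges H. e \<subseteq> verts H"
  shows "inversion (X \<inter> verts H) A = inversion X A"
proof -
  have "u \<in> verts H \<and> v \<in> verts H" if "(u, v) \<in> A" for u v
    using orientationD(1)[OF assms(1) that] assms(2) by auto
  then show ?thesis by (auto simp: in_inversion split: if_splits)
qed

lemma inversion_graph_edgeI:
  "orientation H A \<Longrightarrow> orientation H B \<Longrightarrow> A \<noteq> B \<Longrightarrow> X \<subseteq> verts H \<Longrightarrow> inversion X A = B \<Longrightarrow>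
    {A, B} \<in> edges (inversion_graph H)"
  unfolding inversion_graph_def by auto

lemma walk_imp_inversions:
  "walk (inversion_graph H) ws \<Longrightarrow>
    \<exists>Xs. length Xs = length ws - 1 \<and> fold inversion Xs (hd ws) = last ws"
proof (induction ws rule: induct_list012)
  case (3 A B ws)
  from 3(3) have w: "walk (inversion_graph H) (B # ws)" and e: "{A, B} \<in> edges (inversion_graph H)"
    by (auto simp: walk_def)
  from e obtain X where "inversion X A = B \<or> inversion X B = A"
    by (auto simp: inversion_graph_def doubleton_eq_iff)
  \<comment> \<open>An edge is an unordered pair, so the inversion may lead from \<open>B\<close> to
    \<open>A\<close>; as an involution it also leads back.\<close>
  then have X: "inversion X A = B" using inversion_involution by metis
  from 3(2)[OF w] obtain Xs where "length Xs = length (B # ws) - 1" "fold inversion Xs B = last (B # ws)"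
    by auto
  with X show ?case by (intro exI[of _ "X # Xs"]) auto
qed (auto simp: walk_def)

text \<open>The length is only bounded, since an inversion that changes nothing gives no edge of the
  inversion graph and is dropped from the walk.\<close>

lemma inversions_imp_walk:
  assumes "orientation H A" "\<forall>e\<in>edges H. e \<subseteq> verts H"
  shows "\<exists>ws. walk (inversion_graph H) ws \<and> hd ws = A \<and> last ws = fold inversion Xs A \<and>
    length ws \<le> length Xs + 1"
  using assms(1)
proof (induction Xs arbitrary: A)
  case Nil
  then show ?case by (intro exI[of _ "[A]"]) (auto simp: walk_def inversion_graph_def)
next
  case (Cons X Xs)
  let ?B = "inversion X A"
  have B: "orientation H ?B" using Cons.prems by (rule orientation_inversion)
  from Cons.IH[OF B] obtain ws where ws: "walk (inversion_graph H) ws" "hd ws = ?B"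
    "last ws = fold inversion Xs ?B" "length ws \<le> length Xs + 1" by auto
  show ?case
  proof (cases "?B = A")
    case True
    with ws show ?thesis by (intro exI[of _ ws]) auto
  next
    case False
    have "{A, ?B} \<in> edges (inversion_graph H)"
      by (rule inversion_graph_edgeI[OF Cons.prems B False[symmetric], of "X \<inter> verts H"])
        (simp_all add: inversion_Int_verts[OF Cons.prems assms(2)])
    with ws Cons.prems show ?thesis
      by (intro exI[of _ "A # ws"])
        (auto simp: walk_def successively_Cons inversion_graph_def)
  qed
qed

lemma inversion_dist_le_iff:
  assumes "orientation H A" "orientation H B" "\<forall>e\<in>edges H. e \<subseteq> verts H"
  shows "graph_dist (inversion_graph H) A B \<le> enat k \<longleftrightarrow>
    (\<exists>Xs. length Xs \<le> k \<and> fold inversion Xs A = B)"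
  unfolding graph_dist_def INF_enat_le_iff
proof
  assume "\<exists>ws\<in>{ws. walk (inversion_graph H) ws \<and> hd ws = A \<and> last ws = B}. length ws - 1 \<le> k"
  then obtain ws where ws: "walk (inversion_graph H) ws" "hd ws = A" "last ws = B" "length ws - 1 \<le> k"
    by blast
  obtain Xs where "length Xs = length ws - 1" "fold inversion Xs (hd ws) = last ws"
    using walk_imp_inversions[OF ws(1)] by blast
  then show "\<exists>Xs. length Xs \<le> k \<and> fold inversion Xs A = B"
    using ws by (intro exI[of _ Xs]) simp
next
  assume "\<exists>Xs. length Xs \<le> k \<and> fold inversion Xs A = B"
  then obtain Xs where Xs: "length Xs \<le> k" "fold inversion Xs A = B" by auto
  obtain ws where "walk (inversion_graph H) ws" "hd ws = A" "last ws = B" "length ws \<le> length Xs + 1"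
    using inversions_imp_walk[OF assms(1,3), of Xs] Xs(2) by blast
  then show "\<exists>ws\<in>{ws. walk (inversion_graph H) ws \<and> hd ws = A \<and> last ws = B}. length ws - 1 \<le> k"
    using Xs(1) by (intro bexI[of _ ws]) auto
qed

text \<open>The set \<open>x w\<close> is the vector in \<open>F\<^sub>2\<^sup>k\<close> recording which of the \<open>k\<close> inversions contain \<open>w\<close>.\<close>

lemma inversion_dist_le_iff_vectors:
  assumes A: "orientation H A" and B: "orientation H B"
    and wf: "\<forall>e\<in>edges H. e \<subseteq> verts H"
  shows "graph_dist (inversion_graph H) A B \<le> enat k \<longleftrightarrow>
    (\<exists>x. (\<forall>w. x w \<subseteq> {..<k}) \<and> (\<forall>u v. {u, v} \<in> edges H \<longrightarrow>
      (odd (card (x u \<inter> x v)) \<longleftrightarrow> ((u, v) \<in> A \<longleftrightarrow> (u, v) \<notin> B))))"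
  unfolding inversion_dist_le_iff[OF assms]
proof
  assume "\<exists>Xs. length Xs \<le> k \<and> fold inversion Xs A = B"
  then obtain Xs where Xs: "length Xs \<le> k" "fold inversion Xs A = B" by auto
  define x where "x w = {i. i < length Xs \<and> w \<in> Xs ! i}" for w
  have "odd (card (x u \<inter> x v)) \<longleftrightarrow> ((u, v) \<in> A \<longleftrightarrow> (u, v) \<notin> B)" if "{u, v} \<in> edges H" for u v
  proof -
    have "x u \<inter> x v = {i. i < length Xs \<and> u \<in> Xs ! i \<and> v \<in> Xs ! i}" by (auto simp: x_def)
    then show ?thesis
      using in_fold_inversion[of u v Xs A] orientationD(2)[OF A that] Xs(2) by auto
  qed
  moreover have "x w \<subseteq> {..<k}" for w using Xs(1) by (auto simp: x_def)
  ultimately show "\<exists>x. (\<forall>w. x w \<subseteq> {..<k}) \<and> (\<forall>u v. {u, v} \<in> edges H \<longrightarrow>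
      (odd (card (x u \<inter> x v)) \<longleftrightarrow> ((u, v) \<in> A \<longleftrightarrow> (u, v) \<notin> B)))" by blast
next
  assume "\<exists>x. (\<forall>w. x w \<subseteq> {..<k}) \<and> (\<forall>u v. {u, v} \<in> edges H \<longrightarrow>
      (odd (card (x u \<inter> x v)) \<longleftrightarrow> ((u, v) \<in> A \<longleftrightarrow> (u, v) \<notin> B)))"
  then obtain x where x: "\<And>w. x w \<subseteq> {..<k}" and odd: "\<And>u v. {u, v} \<in> edges H \<Longrightarrow>
      odd (card (x u \<inter> x v)) \<longleftrightarrow> ((u, v) \<in> A \<longleftrightarrow> (u, v) \<notin> B)" by blast
  \<comment> \<open>The coordinates are read by columns: the \<open>i\<close>-th inverted set
    collects the vertices whose vector has coordinate \<open>i\<close>.\<close>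
  define Xs where "Xs = map (\<lambda>i. {w. i \<in> x w}) [0..<k]"
  have "(u, v) \<in> fold inversion Xs A \<longleftrightarrow> (u, v) \<in> B" for u v
  proof (cases "{u, v} \<in> edges H")
    case True
    have "i < k" if "i \<in> x w" for i w using x that by blast
    then have "{i. i < length Xs \<and> u \<in> Xs ! i \<and> v \<in> Xs ! i} = x u \<inter> x v"
      by (auto simp: Xs_def)
    then show ?thesis
      using in_fold_inversion[of u v Xs A] orientationD(2)[OF A True] odd[OF True] by auto
  next
    case False
    then show ?thesis
      using orientationD(1)[OF B] orientationD(1)[OF orientation_fold_inversion[OF A]] by blast
  qed
  then have "fold inversion Xs A = B" by auto
  then show "\<exists>Xs. length Xs \<le> k \<and> fold inversion Xs A = B"
    by (intro exI[of _ Xs]) (auto simp: Xs_def)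
qed

lemma inversion_diam_le_iff:
  "graph_diam (inversion_graph H) \<le> enat k \<longleftrightarrow>
    (\<forall>A B. orientation H A \<longrightarrow> orientation H B \<longrightarrow> graph_dist (inversion_graph H) A B \<le> enat k)"
  by (auto simp: graph_diam_def SUP_le_iff inversion_graph_def)


section \<open>Colourings by nonzero vectors\<close>

text \<open>An injective numbering of the finitely many vertices is a colouring, so the minimum is
  attained; further colours never hurt.\<close>

lemma chromatic_number_le_iff:
  assumes "simple_graph G"
  shows "chromatic_number G \<le> k \<longleftrightarrow> colourable G k"
proof
  obtain f :: "_ \<Rightarrow> nat" and n where f: "f ` verts G = {i. i < n}" "inj_on f (verts G)"
    using assms finite_imp_inj_to_nat_seg unfolding simple_graph_def by metis
  have "f u \<noteq> f v" if "{u, v} \<in> edges G" for u v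
  proof -
    have "{u, v} \<subseteq> verts G" "card {u, v} = 2" using assms that by (auto simp: simple_graph_def)
    then show ?thesis using f(2) by (auto simp: inj_on_def card_2_iff doubleton_eq_iff)
  qed
  then have "colourable G n" using f(1) unfolding colourable_def by (intro exI[of _ f]) auto
  then have "colourable G (chromatic_number G)" unfolding chromatic_number_def by (rule LeastI)
  then show "colourable G k" if "chromatic_number G \<le> k"
    using that unfolding colourable_def by (meson order_less_le_trans)
qed (auto simp: chromatic_number_def intro: Least_le)

text \<open>There are \<open>2 ^ k - 1\<close> nonzero vectors, here nonempty subsets of
  \<open>{..<k}\<close>; a bijection with the colours translates in both directions.\<close>

lemma colourable_iff_vectors:
  assumes "simple_graph G"
  shows "colourable G (2 ^ k - 1) \<longleftrightarrow> (\<exists>x. (\<forall>v\<in>verts G. x v \<subseteq> {..<k} \<and> x v \<noteq> {}) \<and>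
    (\<forall>u v. {u, v} \<in> edges G \<longrightarrow> x u \<noteq> x v))"
proof -
  have E: "u \<in> verts G" "v \<in> verts G" if "{u, v} \<in> edges G" for u v
    using assms that by (auto simp: simple_graph_def)
  have "card (Pow {..<k} - {{}}) = 2 ^ k - 1" by (simp add: card_Diff_subset card_Pow)
  then obtain h where h: "bij_betw h {..<2 ^ k - 1 :: nat} (Pow {..<k} - {{}})"
    by (metis bij_betw_iff_card card_lessThan finite_Diff finite_Pow_iff finite_lessThan)
  show ?thesis
  proof
    assume "colourable G (2 ^ k - 1)"
    then obtain c where c: "\<And>v. v \<in> verts G \<Longrightarrow> c v < 2 ^ k - 1"
      "\<And>u v. {u, v} \<in> edges G \<Longrightarrow> c u \<noteq> (c v :: nat)" by (auto simp: colourable_def)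
    have "h (c v) \<in> Pow {..<k} - {{}}" if "v \<in> verts G" for v
      using h c(1)[OF that] by (auto simp: bij_betw_def)
    moreover have "h (c u) \<noteq> h (c v)" if "{u, v} \<in> edges G" for u v
      using h c(1)[OF E(1)[OF that]] c(1)[OF E(2)[OF that]] c(2)[OF that]
      by (auto simp: bij_betw_def inj_on_def)
    ultimately show "\<exists>x. (\<forall>v\<in>verts G. x v \<subseteq> {..<k} \<and> x v \<noteq> {}) \<and>
      (\<forall>u v. {u, v} \<in> edges G \<longrightarrow> x u \<noteq> x v)"
      by (intro exI[of _ "\<lambda>v. h (c v)"]) auto
  next
    assume "\<exists>x. (\<forall>v\<in>verts G. x v \<subseteq> {..<k} \<and> x v \<noteq> {}) \<and>
      (\<forall>u v. {u, v} \<in> edges G \<longrightarrow> x u \<noteq> x v)"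
    then obtain x where x: "\<And>v. v \<in> verts G \<Longrightarrow> x v \<in> Pow {..<k} - {{}}"
      "\<And>u v. {u, v} \<in> edges G \<Longrightarrow> x u \<noteq> x v" by auto
    define g where "g = inv_into {..<2 ^ k - 1 :: nat} h"
    have g: "bij_betw g (Pow {..<k} - {{}}) {..<2 ^ k - 1}"
      unfolding g_def using h by (rule bij_betw_inv_into)
    have "g (x v) < 2 ^ k - 1" if "v \<in> verts G" for v
      using g x(1)[OF that] unfolding bij_betw_def by blast
    moreover have "g (x u) \<noteq> g (x v)" if "{u, v} \<in> edges G" for u v
      using g x(1)[OF E(1)[OF that]] x(1)[OF E(2)[OF that]] x(2)[OF that]
      by (metis bij_betw_def inj_on_def)
    ultimately show "colourable G (2 ^ k - 1)"
      unfolding colourable_def by (intro exI[of _ "\<lambda>v. g (x v)"]) auto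
  qed
qed

text \<open>Distinct nonzero vectors over \<open>F\<^sub>2\<close> are linearly independent.\<close>

lemma two_parities_solvable:
  assumes "S \<noteq> T" "S \<noteq> {}" "T \<noteq> {}"
  shows "\<exists>Z\<subseteq>S \<union> T. (odd (card (S \<inter> Z)) \<longleftrightarrow> a) \<and> (odd (card (T \<inter> Z)) \<longleftrightarrow> b)"
proof -
  \<comment> \<open>As \<open>t\<close> lies outside \<open>S\<close>, it adjusts the parity on
    \<open>T\<close> alone. First \<open>s\<close> settles the parity on \<open>S\<close>; if
    \<open>s\<close> also lies in \<open>T\<close>, then \<open>t\<close> is added exactly when the
    prescribed parities differ.\<close>
  have sub: ?thesis if T: "t \<in> T" "t \<notin> S" and "s \<in> S" for s t
  proof -
    have "s \<noteq> t" using that by blast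
    consider (both) "s \<in> T" | (one) "s \<notin> T" by blast
    then show ?thesis
    proof cases
      case both
      then show ?thesis
        using that \<open>s \<noteq> t\<close>
        by (intro exI[of _ "(if a then {s} else {}) \<union> (if a \<longleftrightarrow> b then {} else {t})"]) auto
    next
      case one
      then show ?thesis
        using that \<open>s \<noteq> t\<close>
        by (intro exI[of _ "(if a then {s} else {}) \<union> (if b then {t} else {})"]) auto
    qed
  qed
  have sub': ?thesis if "s \<in> S" "s \<notin> T" and "t \<in> T" for s t
  proof -
    have "s \<noteq> t" using that by blast
    consider (both) "t \<in> S" | (one) "t \<notin> S" by blast
    then show ?thesis
    proof cases
      case both
      then show ?thesis
        using that \<open>s \<noteq> t\<close>
        by (intro exI[of _ "(if b then {t} else {}) \<union> (if a \<longleftrightarrow> b then {} else {s})"]) auto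
    next
      case one
      then show ?thesis
        using that \<open>s \<noteq> t\<close>
        by (intro exI[of _ "(if a then {s} else {}) \<union> (if b then {t} else {})"]) auto
    qed
  qed
  \<comment> \<open>Distinct sets have an element in one but not in the other; the second element
    comes from the other set, which is nonempty.\<close>
  from assms show ?thesis using sub sub' by blast
qed


section \<open>Orientations of the subdivision\<close>

lemma edges_subdivision:
  "{a, b} \<in> edges (subdivision G) \<longleftrightarrow> (\<exists>v e. e \<in> edges G \<and> v \<in> e \<and>
    (a = Inl v \<and> b = Inr e \<or> a = Inr e \<and> b = Inl v))"
  by (auto simp: subdivision_def doubleton_eq_iff)

lemma subdivision_edge_subset:
  "simple_graph G \<Longrightarrow> \<forall>e\<in>edges (subdivision G). e \<subseteq> verts (subdivision G)"
  by (auto simp: subdivision_def simple_graph_def)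

lemma colourable_imp_dist_le:
  assumes G: "simple_graph G" and col: "colourable G (2 ^ k - 1)"
    and A: "orientation (subdivision G) A" and B: "orientation (subdivision G) B"
  shows "graph_dist (inversion_graph (subdivision G)) A B \<le> enat k"
proof -
  obtain x where x: "\<And>v. v \<in> verts G \<Longrightarrow> x v \<subseteq> {..<k} \<and> x v \<noteq> {}"
    and ne: "\<And>u v. {u, v} \<in> edges G \<Longrightarrow> x u \<noteq> x v"
    using col unfolding colourable_iff_vectors[OF G] by blast
  have "\<exists>Z\<subseteq>{..<k}. \<forall>w\<in>e. odd (card (x w \<inter> Z)) \<longleftrightarrow> ((Inl w, Inr e) \<in> A \<longleftrightarrow> (Inl w, Inr e) \<notin> B)"
    if e: "e \<in> edges G" for e
  proof -
    obtain u v where uv: "e = {u, v}" "u \<in> verts G" "v \<in> verts G"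
      using G e unfolding simple_graph_def by (metis card_2_iff insert_subset)
    \<comment> \<open>The prescribed parities say which halves of \<open>e\<close> are to be
      reversed on the way from \<open>A\<close> to \<open>B\<close>.\<close>
    from two_parities_solvable[OF ne[of u v], of "(Inl u, Inr e) \<in> A \<longleftrightarrow> (Inl u, Inr e) \<notin> B"
        "(Inl v, Inr e) \<in> A \<longleftrightarrow> (Inl v, Inr e) \<notin> B"] uv e x
    obtain Z where "Z \<subseteq> x u \<union> x v" "odd (card (x u \<inter> Z)) \<longleftrightarrow> ((Inl u, Inr e) \<in> A \<longleftrightarrow> (Inl u, Inr e) \<notin> B)"
      "odd (card (x v \<inter> Z)) \<longleftrightarrow> ((Inl v, Inr e) \<in> A \<longleftrightarrow> (Inl v, Inr e) \<notin> B)" by metis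
    with uv x[OF uv(2)] x[OF uv(3)] show ?thesis by (intro exI[of _ Z]) (simp, blast)
  qed
  then obtain z where z: "\<And>e. e \<in> edges G \<Longrightarrow> z e \<subseteq> {..<k}"
    "\<And>e w. e \<in> edges G \<Longrightarrow> w \<in> e \<Longrightarrow>
      odd (card (x w \<inter> z e)) \<longleftrightarrow> ((Inl w, Inr e) \<in> A \<longleftrightarrow> (Inl w, Inr e) \<notin> B)" by metis
  define y where "y = case_sum x z"
  \<comment> \<open>The colouring constrains \<open>x\<close> on the vertices of \<open>G\<close>
    only, but the vectors must lie in \<open>{..<k}\<close> everywhere. Truncation keeps the
    relevant intersections because \<open>z e\<close> is inside already.\<close>
  define y' where "y' w = y w \<inter> {..<k}" for w
  have yi: "y' (Inl w) \<inter> y' (Inr e) = x w \<inter> z e" if "e \<in> edges G" for w e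
    using z(1)[OF that] by (auto simp: y'_def y_def)
  have "odd (card (y' a \<inter> y' b)) \<longleftrightarrow> ((a, b) \<in> A \<longleftrightarrow> (a, b) \<notin> B)"
    if ab: "{a, b} \<in> edges (subdivision G)" for a b
  proof -
    from ab obtain v e where e: "e \<in> edges G" "v \<in> e"
      and "a = Inl v \<and> b = Inr e \<or> a = Inr e \<and> b = Inl v"
      unfolding edges_subdivision by blast
    then show ?thesis
      using z(2)[OF e] yi[OF e(1), of v] orientationD(2)[OF A ab] orientationD(2)[OF B ab]
      by (auto simp: Int_commute)
  qed
  then show ?thesis
    unfolding inversion_dist_le_iff_vectors[OF A B subdivision_edge_subset[OF G]]
    by (intro exI[of _ y']) (auto simp: y'_def)
qed

section \<open>Two orientations whose distance forces a colouring\<close>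

definition inward :: "'a graph \<Rightarrow> (('a + 'a set) \<times> ('a + 'a set)) set" where
  "inward G = {(Inl v, Inr e) | v e. e \<in> edges G \<and> v \<in> e}"

text \<open>If \<open>t e\<close> is an end of \<open>e\<close>, this differs from
  \<open>inward\<close> on \<open>e\<close> exactly in the half at \<open>t e\<close>, which makes
  the subdivided edge a directed path.\<close>

definition through :: "'a graph \<Rightarrow> ('a set \<Rightarrow> 'a) \<Rightarrow> (('a + 'a set) \<times> ('a + 'a set)) set" where
  "through G t = {(Inr e, Inl (t e)) | e. e \<in> edges G} \<union>
    {(Inl v, Inr e) | v e. e \<in> edges G \<and> v \<in> e \<and> v \<noteq> t e}"

lemma orientation_inward: "orientation (subdivision G) (inward G)"
  by (auto simp: orientation_def edges_subdivision inward_def)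

lemma orientation_through:
  "\<forall>e\<in>edges G. t e \<in> e \<Longrightarrow> orientation (subdivision G) (through G t)"
  unfolding orientation_def edges_subdivision through_def by fast

lemma dist_inward_through_imp_colourable:
  assumes G: "simple_graph G" and t: "\<forall>e\<in>edges G. t e \<in> e"
    and surj: "verts G \<subseteq> t ` edges G"
    and dist: "graph_dist (inversion_graph (subdivision G)) (inward G) (through G t) \<le> enat k"
  shows "colourable G (2 ^ k - 1)"
proof -
  have "\<exists>y. (\<forall>w. y w \<subseteq> {..<k}) \<and> (\<forall>u v. {u, v} \<in> edges (subdivision G) \<longrightarrow>
      (odd (card (y u \<inter> y v)) \<longleftrightarrow> ((u, v) \<in> inward G \<longleftrightarrow> (u, v) \<notin> through G t)))"
    using dist inversion_dist_le_iff_vectors[OF orientation_inward orientation_through[OF t]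
        subdivision_edge_subset[OF G]] by simp
  then obtain y where y: "\<And>w. y w \<subseteq> {..<k}" and odd: "\<And>u v. {u, v} \<in> edges (subdivision G) \<Longrightarrow>
      odd (card (y u \<inter> y v)) \<longleftrightarrow> ((u, v) \<in> inward G \<longleftrightarrow> (u, v) \<notin> through G t)" by blast
  \<comment> \<open>Only the half at \<open>t e\<close> is reversed, so the vector of the
    subdividing vertex separates the two ends of \<open>e\<close>, and the vector of
    \<open>t e\<close> is nonzero.\<close>
  have flip: "odd (card (y (Inl v) \<inter> y (Inr e))) \<longleftrightarrow> v = t e" if "e \<in> edges G" "v \<in> e" for v e
    using odd[of "Inl v" "Inr e"] that by (auto simp: edges_subdivision inward_def through_def)
  have "y (Inl v) \<noteq> {}" if "v \<in> verts G" for v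
  proof -
    from that surj obtain e where "e \<in> edges G" "v = t e" by blast
    then show ?thesis using flip[of e v] t by auto
  qed
  moreover have "y (Inl u) \<noteq> y (Inl v)" if "{u, v} \<in> edges G" for u v
  proof -
    have "u \<noteq> v" using G that by (auto simp: simple_graph_def)
    then show ?thesis using flip[OF that, of u] flip[OF that, of v] t that by auto
  qed
  ultimately show ?thesis
    unfolding colourable_iff_vectors[OF G] using y by (intro exI[of _ "\<lambda>v. y (Inl v)"]) auto
qed

text \<open>The implications close a cycle: a bound on the diameter bounds this one distance, which
  yields a colouring, which in turn bounds every distance.\<close>

lemma inversion_equivalences:
  assumes "simple_graph G" "\<forall>e\<in>edges G. t e \<in> e" "verts G \<subseteq> t ` edges G"
  shows "graph_dist (inversion_graph (subdivision G)) (inward G) (through G t) \<le> enat k \<longleftrightarrow>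
      graph_diam (inversion_graph (subdivision G)) \<le> enat k" (is "?dist \<longleftrightarrow> ?diam")
    and "graph_diam (inversion_graph (subdivision G)) \<le> enat k \<longleftrightarrow> chromatic_number G \<le> 2 ^ k - 1"
proof -
  have "?dist" if ?diam
    using that orientation_inward orientation_through[of G t] assms(2)
    unfolding inversion_diam_le_iff by blast
  moreover have "chromatic_number G \<le> 2 ^ k - 1" if ?dist
    using dist_inward_through_imp_colourable[OF assms that] chromatic_number_le_iff[OF assms(1)] by blast
  moreover have ?diam if "chromatic_number G \<le> 2 ^ k - 1"
    using that colourable_imp_dist_le[OF assms(1)]
    unfolding chromatic_number_le_iff[OF assms(1)] inversion_diam_le_iff by blast
  ultimately show "?dist \<longleftrightarrow> ?diam" "?diam \<longleftrightarrow> chromatic_number G \<le> 2 ^ k - 1" by blast+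
qed


section \<open>Executing programs\<close>

primrec loop_free :: "com \<Rightarrow> bool" where
  "loop_free (Const r n) = True"
| "loop_free (Add r a b) = True"
| "loop_free (Sub r a b) = True"
| "loop_free (Load r a) = True"
| "loop_free (Store a r) = True"
| "loop_free (Seq c d) = (loop_free c \<and> loop_free d)"
| "loop_free (IfNZ r c d) = (loop_free c \<and> loop_free d)"
| "loop_free (WhileNZ r c) = False"

text \<open>The value on loops is junk; \<open>run\<close> and \<open>cost\<close> are only meant for loop-free programs.\<close>

primrec run :: "com \<Rightarrow> ram_state \<Rightarrow> ram_state" where
  "run (Const r n) s = ((fst s)(r := n), snd s)"
| "run (Add r a b) s = ((fst s)(r := fst s a + fst s b), snd s)"
| "run (Sub r a b) s = ((fst s)(r := fst s a - fst s b), snd s)"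
| "run (Load r a) s = ((fst s)(r := snd s (fst s a)), snd s)"
| "run (Store a r) s = (fst s, (snd s)(fst s a := fst s r))"
| "run (Seq c d) s = run d (run c s)"
| "run (IfNZ r c d) s = (if fst s r \<noteq> 0 then run c s else run d s)"
| "run (WhileNZ r c) s = s"

text \<open>Adding both branches of a conditional overestimates the time but makes it independent of
  the state.\<close>

primrec cost :: "com \<Rightarrow> nat" where
  "cost (Const r n) = 1"
| "cost (Add r a b) = 1"
| "cost (Sub r a b) = 1"
| "cost (Load r a) = 1"
| "cost (Store a r) = 1"
| "cost (Seq c d) = cost c + cost d"
| "cost (IfNZ r c d) = cost c + cost d + 1"
| "cost (WhileNZ r c) = 0"

definition exec_within :: "com \<Rightarrow> ram_state \<Rightarrow> nat \<Rightarrow> ram_state \<Rightarrow> bool" where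
  "exec_within c s T s' \<longleftrightarrow> (\<exists>t\<le>T. exec c s t s')"

lemma exec_within_run: "loop_free c \<Longrightarrow> exec_within c s (cost c) (run c s)"
  unfolding exec_within_def
proof (induction c arbitrary: s)
  case (Seq c d)
  from Seq.prems obtain t t' where "t \<le> cost c" "exec c s t (run c s)"
    "t' \<le> cost d" "exec d (run c s) t' (run d (run c s))"
    using Seq.IH(1)[of s] Seq.IH(2)[of "run c s"] by auto
  then show ?case by (intro exI[of _ "t + t'"]) (auto intro: exec.Seq)
next
  case (IfNZ r c d)
  show ?case
  proof (cases "fst s r = 0")
    case True
    obtain t where "t \<le> cost d" "exec d s t (run d s)" using IfNZ.IH(2)[of s] IfNZ.prems by auto
    with True show ?thesis by (intro exI[of _ "t + 1"]) (auto intro!: exec.IfFalse[of s r, simplified])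
  next
    case False
    obtain t where "t \<le> cost c" "exec c s t (run c s)" using IfNZ.IH(1)[of s] IfNZ.prems by auto
    with False show ?thesis by (intro exI[of _ "t + 1"]) (auto intro!: exec.IfTrue[of s r, simplified])
  qed
next
  case (Const r n) show ?case by (cases s) (auto intro!: exI[of _ 1] exec.Const[simplified])
next
  case (Add r a b) show ?case by (cases s) (auto intro!: exI[of _ 1] exec.Add[simplified])
next
  case (Sub r a b) show ?case by (cases s) (auto intro!: exI[of _ 1] exec.Sub[simplified])
next
  case (Load r a) show ?case by (cases s) (auto intro!: exI[of _ 1] exec.Load[simplified])
next
  case (Store a r) show ?case by (cases s) (auto intro!: exI[of _ 1] exec.Store[simplified])
qed auto

lemma exec_within_Seq:
  "exec_within c s T s' \<Longrightarrow> exec_within d s' T' s'' \<Longrightarrow> exec_within (Seq c d) s (T + T') s''"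
  unfolding exec_within_def by (meson add_mono exec.Seq)

text \<open>\<open>b\<close> is a termination measure carried by the invariant. It bounds the number
  of rounds, each costing the body and one test; the final 1 is the failing test.\<close>

lemma exec_within_While:
  assumes "loop_free c" "I b s"
    and step: "\<And>b s. I b s \<Longrightarrow> fst s r \<noteq> 0 \<Longrightarrow> \<exists>b'<b. I b' (run c s)"
  shows "\<exists>b' s'. exec_within (WhileNZ r c) s (b * (cost c + 1) + 1) s' \<and> I b' s' \<and> fst s' r = 0"
  using assms(2)
proof (induction b arbitrary: s rule: less_induct)
  case (less b)
  show ?case
  proof (cases "fst s r = 0")
    case True
    then show ?thesis
      using less.prems exec.WhileFalse[OF True, of c] unfolding exec_within_def
      by (intro exI[of _ b] exI[of _ s]) auto
  next
    case False
    from step[OF less.prems this] obtain b' where b': "b' < b" "I b' (run c s)" by auto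
    from less.IH[OF this] obtain b'' s' t' where
      s': "exec (WhileNZ r c) (run c s) t' s'" "t' \<le> b' * (cost c + 1) + 1" "I b'' s'" "fst s' r = 0"
      by (auto simp: exec_within_def)
    obtain t where t: "t \<le> cost c" "exec c s t (run c s)"
      using exec_within_run[OF assms(1), of s] unfolding exec_within_def by blast
    have "exec (WhileNZ r c) s (t + t' + 1) s'" using False t(2) s'(1) by (rule exec.WhileTrue)
    moreover have "t + t' + 1 \<le> (b' + 1) * (cost c + 1) + 1" using t(1) s'(2) by simp
    moreover have "(b' + 1) * (cost c + 1) \<le> b * (cost c + 1)" using b'(1) by (intro mult_right_mono) auto
    ultimately have "exec_within (WhileNZ r c) s (b * (cost c + 1) + 1) s'"
      unfolding exec_within_def by (intro exI[of _ "t + t' + 1"]) linarith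
    with s' show ?thesis by blast
  qed
qed

abbreviation (input) seq_com :: "com \<Rightarrow> com \<Rightarrow> com" (infixr ";;" 60) where
  "c ;; d \<equiv> Seq c d"


section \<open>Choosing a private edge for every vertex\<close>

text \<open>The selection is recorded in place, by storing the selected end of an edge first. Edges
  keep their positions, and hence the subdividing vertices keep their numbers.\<close>

definition reorients :: "(nat \<times> nat) list \<Rightarrow> (nat \<times> nat) list \<Rightarrow> bool" where
  "reorients = list_all2 (\<lambda>p q. q = p \<or> q = prod.swap p)"

text \<open>
  The walk stands at \<open>cur\<close>, having arrived through the edge stored at address \<open>lp\<close> (\<open>0\<close> if the walk
  has just started); the edge number \<open>i\<close> is stored at \<open>2 + 2 * i\<close>. Every marked vertex is the
  first component of an edge whose other end is marked too, except possibly for the edge just used.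
\<close>

definition owns_edges :: "(nat \<times> nat) list \<Rightarrow> nat set \<Rightarrow> nat \<Rightarrow> nat \<Rightarrow> bool" where
  "owns_edges qs K cur lp \<longleftrightarrow> (\<forall>u\<in>K. \<exists>i<length qs. fst (qs ! i) = u \<and>
    (snd (qs ! i) \<in> K \<or> snd (qs ! i) = cur \<and> lp = 2 + 2 * i))"

text \<open>\<open>K\<close> holds the marked vertices, \<open>v\<close> is the start of the current
  walk and \<open>j\<close> the next edge to inspect at \<open>cur\<close>. The clause
  \<open>cur = v \<or> v \<in> K\<close> ensures that \<open>v\<close> is marked once the walk meets
  a marked vertex, so that the next start can be tried. At the end \<open>v = n\<close>, and
  \<open>cur\<close> need not be a vertex.\<close>

definition walk_inv ::
    "nat \<Rightarrow> (nat \<times> nat) list \<Rightarrow> (nat \<times> nat) list \<Rightarrow> nat set \<Rightarrow> nat \<Rightarrow> nat \<Rightarrow> nat \<Rightarrow> nat \<Rightarrow> bool" where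
  "walk_inv n ps qs K v cur lp j \<longleftrightarrow>
    reorients ps qs \<and> v \<le> n \<and> (v < n \<longrightarrow> cur < n) \<and>
    K \<subseteq> {..<n} \<and> {..<v} \<subseteq> K \<and> (cur = v \<or> v \<in> K) \<and> owns_edges qs K cur lp \<and>
    (\<forall>i<j. lp = 2 + 2 * i \<or> cur \<noteq> fst (qs ! i) \<and> cur \<noteq> snd (qs ! i))"

text \<open>Degree at least two in the form that the walk needs: whichever edge \<open>l\<close> is
  discarded, such as the arrival edge, another one remains at \<open>u\<close>.\<close>

definition min_degree_two :: "nat \<Rightarrow> (nat \<times> nat) list \<Rightarrow> bool" where
  "min_degree_two n ps \<longleftrightarrow>
    (\<forall>u<n. \<forall>l. \<exists>i<length ps. i \<noteq> l \<and> (u = fst (ps ! i) \<or> u = snd (ps ! i)))"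

lemma reorients_length: "reorients ps qs \<Longrightarrow> length qs = length ps"
  by (simp add: reorients_def list_all2_lengthD)

lemma reorients_nth:
  "reorients ps qs \<Longrightarrow> i < length ps \<Longrightarrow> qs ! i = ps ! i \<or> qs ! i = prod.swap (ps ! i)"
  unfolding reorients_def by (drule (1) list_all2_nthD)

lemma reorients_update:
  assumes "reorients ps qs" "j < length qs" "qs ! j = (a, b) \<or> qs ! j = (b, a)"
  shows "reorients ps (qs[j := (a, b)])"
  unfolding reorients_def list_all2_conv_all_nth
proof (intro conjI allI impI)
  show "length ps = length (qs[j := (a, b)])" using reorients_length[OF assms(1)] by simp
  fix i assume i: "i < length ps"
  show "qs[j := (a, b)] ! i = ps ! i \<or> qs[j := (a, b)] ! i = prod.swap (ps ! i)"
    using reorients_nth[OF assms(1) i] assms(2,3) by (cases "i = j"; cases "ps ! i") auto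
qed

text \<open>At a marked \<open>cur\<close> the exception for the edge just used disappears, since
  that edge now ends in a marked vertex as well.\<close>

lemma walk_inv_next:
  "walk_inv n ps qs K v cur lp j \<Longrightarrow> v < n \<Longrightarrow> cur \<in> K \<Longrightarrow> walk_inv n ps qs K (v + 1) (v + 1) 0 0"
  unfolding walk_inv_def owns_edges_def by (auto simp: less_Suc_eq)

lemma walk_inv_skip:
  "walk_inv n ps qs K v cur lp j \<Longrightarrow> j < length qs \<Longrightarrow>
    lp = 2 + 2 * j \<or> cur \<noteq> fst (qs ! j) \<and> cur \<noteq> snd (qs ! j) \<Longrightarrow>
    walk_inv n ps qs K v cur lp (j + 1)"
  unfolding walk_inv_def by (auto simp: less_Suc_eq)

lemma walk_inv_take:
  assumes inv: "walk_inv n ps qs K v cur lp j" and "v < n" "cur \<notin> K" "j < length qs" "lp \<noteq> 2 + 2 * j"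
    and e: "qs ! j = (cur, w) \<or> qs ! j = (w, cur)" and w: "w < n"
  shows "walk_inv n ps (qs[j := (cur, w)]) (insert cur K) v w (2 + 2 * j) 0"
proof -
  have "owns_edges (qs[j := (cur, w)]) (insert cur K) w (2 + 2 * j)"
    unfolding owns_edges_def
  proof
    fix u assume u: "u \<in> insert cur K"
    show "\<exists>i<length (qs[j := (cur, w)]). fst (qs[j := (cur, w)] ! i) = u \<and>
      (snd (qs[j := (cur, w)] ! i) \<in> insert cur K \<or> snd (qs[j := (cur, w)] ! i) = w \<and> 2 + 2 * j = 2 + 2 * i)"
    proof (cases "u = cur")
      case True
      then show ?thesis using assms(4) by (intro exI[of _ j]) auto
    next
      case False
      with u inv obtain i where i: "i < length qs" "fst (qs ! i) = u"
        "snd (qs ! i) \<in> K \<or> snd (qs ! i) = cur \<and> lp = 2 + 2 * i"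
        unfolding walk_inv_def owns_edges_def by blast
      \<comment> \<open>If \<open>u\<close> owned the edge \<open>j\<close>, its other end would be
        the unmarked \<open>cur\<close>. Then \<open>owns_edges\<close> makes it the arrival edge,
        contrary to \<open>lp \<noteq> 2 + 2 * j\<close>.\<close>
      have "i \<noteq> j" using i e False assms(3,5) by auto
      with i show ?thesis by (intro exI[of _ i]) auto
    qed
  qed
  then show ?thesis
    using assms reorients_update[of ps qs j cur w] unfolding walk_inv_def by auto
qed

text \<open>The edges inspected so far miss \<open>cur\<close> or are the arrival edge, whereas
  minimum degree two provides another edge at \<open>cur\<close>; it is still ahead of the
  scan.\<close>

lemma walk_inv_scan_bound:
  assumes inv: "walk_inv n ps qs K v cur lp j" and "v < n" "cur \<notin> K" and deg: "min_degree_two n ps"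
  shows "j < length qs"
proof -
  have re: "reorients ps qs" and "cur < n" using inv assms(2) by (auto simp: walk_inv_def)
  \<comment> \<open>\<open>(lp - 2) div 2\<close> is the number of the arrival edge. For
    \<open>lp = 0\<close> truncation makes it 0, and excluding that one edge does no harm.\<close>
  with deg obtain i where i: "i < length ps" "i \<noteq> (lp - 2) div 2" "cur = fst (ps ! i) \<or> cur = snd (ps ! i)"
    unfolding min_degree_two_def by blast
  have "cur = fst (qs ! i) \<or> cur = snd (qs ! i)"
    using reorients_nth[OF re i(1)] i(3) by (auto simp: prod.swap_def)
  moreover have "lp \<noteq> 2 + 2 * i" using i(2) by auto
  ultimately have "\<not> i < j" using inv unfolding walk_inv_def by blast
  then show ?thesis using i(1) reorients_length[OF re] by simp
qed

lemma walk_inv_end: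
  assumes "walk_inv n ps qs K n cur lp j" "u < n"
  shows "\<exists>i<length qs. fst (qs ! i) = u"
  using assms unfolding walk_inv_def owns_edges_def by blast


section \<open>The program\<close>

text \<open>
  Registers \<open>6\<close>, \<open>7\<close> and \<open>16\<close> hold the constants \<open>1\<close>, \<open>2\<close> and \<open>0\<close>. The marks are stored behind the
  input, at addresses starting with the input length in register \<open>0\<close>.
\<close>

definition walk_init :: com where
  "walk_init = Const 6 1 ;; Const 7 2 ;; Load 1 16 ;; Const 5 2 ;; Add 10 1 16"

text \<open>Registers 1 to 5 hold \<open>n\<close>, \<open>v\<close>, \<open>cur\<close>,
  \<open>lp\<close> and the address of the inspected edge. Equality is tested by adding both
  truncated differences, which gives 0 exactly if the numbers agree. A chosen edge whose second end
  is \<open>cur\<close> has its ends swapped in memory.\<close>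

definition walk_step :: com where
  "walk_step =
    Add 8 0 3 ;; Load 9 8 ;;
    IfNZ 9
      (Add 2 2 6 ;; Add 3 2 16 ;; Const 4 0 ;; Const 5 2 ;; Sub 10 1 2)
      (Sub 11 4 5 ;; Sub 12 5 4 ;; Add 11 11 12 ;;
       IfNZ 11
         (Add 12 5 6 ;; Load 13 5 ;; Load 14 12 ;;
          Sub 11 3 13 ;; Sub 15 13 3 ;; Add 11 11 15 ;;
          IfNZ 11
            (Sub 11 3 14 ;; Sub 15 14 3 ;; Add 11 11 15 ;;
             IfNZ 11
               (Add 5 5 7)
               (Store 5 14 ;; Store 12 13 ;; Store 8 6 ;; Add 4 5 16 ;; Add 3 13 16 ;; Const 5 2))
            (Store 8 6 ;; Add 4 5 16 ;; Add 3 14 16 ;; Const 5 2))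
         (Add 5 5 7))"

text \<open>The machine cannot halve, so for \<open>m\<close> edges \<open>n + m\<close> is found by
  raising register 2 from \<open>n\<close> in steps of 1 while register 10 falls from
  \<open>2 * m\<close> in steps of 2.\<close>

definition count_init :: com where
  "count_init = Add 2 1 16 ;; Sub 5 0 7 ;; Add 3 5 5 ;; Add 10 5 16"

definition count_step :: com where
  "count_step = Add 2 2 6 ;; Sub 10 10 7"

text \<open>Register 5 holds twice the number of unread edges, which is the address of the last of
  them because the input edges start at 2. For the edge \<open>j\<close> of \<open>m\<close>, the
  arcs of the two orientations go to \<open>4 * j\<close> and \<open>4 * m + 4 * j\<close>.\<close>

definition emit_step :: com where
  "emit_step =
    Load 11 5 ;; Add 8 5 6 ;; Load 12 8 ;; Sub 5 5 7 ;; Sub 2 2 6 ;;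
    Add 8 5 5 ;; Store 8 11 ;; Add 8 8 6 ;; Store 8 2 ;;
    Add 8 8 6 ;; Store 8 12 ;; Add 8 8 6 ;; Store 8 2 ;;
    Add 8 5 5 ;; Add 8 8 3 ;; Store 8 2 ;; Add 8 8 6 ;; Store 8 11 ;;
    Add 8 8 6 ;; Store 8 12 ;; Add 8 8 6 ;; Store 8 2"

definition orient_program :: com where
  "orient_program =
    walk_init ;; WhileNZ 10 walk_step ;; count_init ;; WhileNZ 10 count_step ;;
    WhileNZ 5 emit_step ;; Add 0 3 3"

section \<open>Correctness of the walk loop\<close>

definition walk_regs :: "nat \<Rightarrow> nat \<Rightarrow> nat \<Rightarrow> nat \<Rightarrow> nat \<Rightarrow> nat \<Rightarrow> (nat \<Rightarrow> nat) \<Rightarrow> bool" where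
  "walk_regs m n v cur lp j R \<longleftrightarrow>
    R 0 = 2 + 2 * m \<and> R 1 = n \<and> R 2 = v \<and> R 3 = cur \<and> R 4 = lp \<and> R 5 = 2 + 2 * j \<and>
    R 6 = 1 \<and> R 7 = 2 \<and> R 10 = n - v \<and> R 16 = 0"

text \<open>The four outcomes of a round: a marked vertex, an edge to pass over, an edge stored with
  \<open>cur\<close> first, and one stored with \<open>cur\<close> second. The last requires
  \<open>w \<noteq> cur\<close> because the first end is tested first.\<close>

lemma run_walk_step:
  assumes "walk_regs m n v cur lp j R"
  shows "M (2 + 2 * m + cur) \<noteq> 0 \<Longrightarrow>
      walk_regs m n (v + 1) (v + 1) 0 0 (fst (run walk_step (R, M))) \<and> snd (run walk_step (R, M)) = M"
    and "M (2 + 2 * m + cur) = 0 \<Longrightarrow> lp = 2 + 2 * j \<or> cur \<noteq> M (2 + 2 * j) \<and> cur \<noteq> M (3 + 2 * j) \<Longrightarrow>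
      walk_regs m n v cur lp (j + 1) (fst (run walk_step (R, M))) \<and> snd (run walk_step (R, M)) = M"
    and "M (2 + 2 * m + cur) = 0 \<Longrightarrow> lp \<noteq> 2 + 2 * j \<Longrightarrow> M (2 + 2 * j) = cur \<Longrightarrow> M (3 + 2 * j) = w \<Longrightarrow>
      walk_regs m n v w (2 + 2 * j) 0 (fst (run walk_step (R, M))) \<and>
      snd (run walk_step (R, M)) = M(2 + 2 * m + cur := 1)"
    and "M (2 + 2 * m + cur) = 0 \<Longrightarrow> lp \<noteq> 2 + 2 * j \<Longrightarrow> w \<noteq> cur \<Longrightarrow>
      M (2 + 2 * j) = w \<Longrightarrow> M (3 + 2 * j) = cur \<Longrightarrow>
      walk_regs m n v w (2 + 2 * j) 0 (fst (run walk_step (R, M))) \<and>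
      snd (run walk_step (R, M)) = M(2 + 2 * j := cur, 3 + 2 * j := w, 2 + 2 * m + cur := 1)"
  using assms by (auto simp: walk_regs_def walk_step_def numeral_3_eq_3)

definition stores :: "(nat \<Rightarrow> nat) \<Rightarrow> nat \<Rightarrow> (nat \<times> nat) list \<Rightarrow> nat set \<Rightarrow> bool" where
  "stores M n qs K \<longleftrightarrow>
    (\<forall>i<length qs. M (2 + 2 * i) = fst (qs ! i) \<and> M (3 + 2 * i) = snd (qs ! i)) \<and>
    (\<forall>u<n. M (2 + 2 * length qs + u) \<noteq> 0 \<longleftrightarrow> u \<in> K)"

lemma stores_mark:
  "stores M n qs K \<Longrightarrow> u < n \<Longrightarrow> stores (M(2 + 2 * length qs + u := 1)) n qs (insert u K)"
  unfolding stores_def by auto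

lemma stores_update:
  assumes "stores M n qs K" "j < length qs"
  shows "stores (M(2 + 2 * j := a, 3 + 2 * j := b)) n (qs[j := (a, b)]) K"
proof -
  have "2 + 2 * i \<noteq> 3 + 2 * j" "3 + 2 * i \<noteq> 2 + 2 * j" for i by presburger+
  with assms show ?thesis unfolding stores_def by (auto simp: nth_list_update)
qed

text \<open>\<open>b\<close> measures progress lexicographically: advancing \<open>v\<close> or
  marking a vertex outweighs resetting \<open>j\<close> to 0, because the weight
  \<open>length qs + 1\<close> exceeds every value of \<open>length qs - j\<close>.\<close>

definition walk_state ::
    "nat \<Rightarrow> (nat \<times> nat) list \<Rightarrow> nat \<Rightarrow> ram_state \<Rightarrow> bool" where
  "walk_state n ps b s \<longleftrightarrow> (\<exists>qs K v cur lp j.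
    walk_inv n ps qs K v cur lp j \<and> walk_regs (length qs) n v cur lp j (fst s) \<and>
    stores (snd s) n qs K \<and>
    b = (n - v + (n - card K)) * (length qs + 1) + (length qs - j))"

lemma walk_state_step:
  assumes deg: "min_degree_two n ps" and bd: "\<forall>(a, b)\<in>set ps. a < n \<and> b < n"
    and st: "walk_state n ps b s" and guard: "fst s 10 \<noteq> 0"
  shows "\<exists>b'<b. walk_state n ps b' (run walk_step s)"
proof -
  obtain R M where s: "s = (R, M)" by (cases s)
  from st obtain qs K v cur lp j where
    inv: "walk_inv n ps qs K v cur lp j" and regs: "walk_regs (length qs) n v cur lp j R" and
    mem: "stores M n qs K" and
    b: "b = (n - v + (n - card K)) * (length qs + 1) + (length qs - j)"
    unfolding walk_state_def s by auto
  have v: "v < n" using guard regs unfolding s by (auto simp: walk_regs_def)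
  have cur: "cur < n" and K: "K \<subseteq> {..<n}" and re: "reorients ps qs"
    using inv v by (auto simp: walk_inv_def)
  note len = reorients_length[OF re]
  show ?thesis
  proof (cases "cur \<in> K")
    case True
    have M: "M (2 + 2 * length qs + cur) \<noteq> 0" using mem cur True by (simp add: stores_def)
    let ?b = "(n - (v + 1) + (n - card K)) * (length qs + 1) + (length qs - 0)"
    define c where "c = n - (v + 1) + (n - card K)"
    have c: "n - v + (n - card K) = Suc c" using v by (simp add: c_def)
    have "?b < b" unfolding b c c_def[symmetric] by simp
    moreover have "walk_state n ps ?b (run walk_step s)"
      unfolding walk_state_def s
      using walk_inv_next[OF inv v True] run_walk_step(1)[where M = M, OF regs M] mem
      by (intro exI[of _ qs] exI[of _ K] exI[of _ "v + 1"] exI[of _ 0]) auto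
    ultimately show ?thesis by blast
  next
    case False
    have M: "M (2 + 2 * length qs + cur) = 0" using mem cur False unfolding stores_def by blast
    have jl: "j < length qs" using walk_inv_scan_bound[OF inv v False deg] .
    have Mj: "M (2 + 2 * j) = fst (qs ! j)" "M (3 + 2 * j) = snd (qs ! j)"
      using mem jl by (auto simp: stores_def)
    have "ps ! j \<in> set ps" using jl len by simp
    then have "fst (ps ! j) < n \<and> snd (ps ! j) < n" using bd by (auto simp: split_beta)
    then have qn: "fst (qs ! j) < n" "snd (qs ! j) < n"
      using reorients_nth[OF re, of j] jl len by auto
    have fin: "finite K" using K finite_subset by blast
    have "card (insert cur K) \<le> card {..<n}" using K cur by (intro card_mono) auto
    then have "n - card K = Suc (n - card (insert cur K))" using False fin by simp
    then have less: "(n - v + (n - card (insert cur K))) * (length qs + 1) + (length qs - 0) < b"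
      unfolding b by simp
    consider (skip) "lp = 2 + 2 * j \<or> cur \<noteq> fst (qs ! j) \<and> cur \<noteq> snd (qs ! j)"
      | (out) "lp \<noteq> 2 + 2 * j" "fst (qs ! j) = cur"
      | (in') "lp \<noteq> 2 + 2 * j" "fst (qs ! j) \<noteq> cur" "snd (qs ! j) = cur"
      by blast
    then show ?thesis
    proof cases
      case skip
      let ?b = "(n - v + (n - card K)) * (length qs + 1) + (length qs - (j + 1))"
      have "?b < b" unfolding b using jl by (intro add_strict_left_mono) simp
      moreover have "walk_state n ps ?b (run walk_step s)"
        unfolding walk_state_def s
        using walk_inv_skip[OF inv jl skip] run_walk_step(2)[where M = M, OF regs M] skip Mj mem
        by (intro exI[of _ qs] exI[of _ K] exI[of _ v] exI[of _ cur] exI[of _ lp] exI[of _ "j + 1"]) auto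
      ultimately show ?thesis by blast
    next
      case out
      let ?w = "snd (qs ! j)"
      have e: "qs ! j = (cur, ?w)" using out by (cases "qs ! j") auto
      \<comment> \<open>The edge is already stored with \<open>cur\<close> first, so the list update
        changes nothing.\<close>
      have "walk_inv n ps qs (insert cur K) v ?w (2 + 2 * j) 0"
        using walk_inv_take[OF inv v False jl out(1) disjI1[OF e] qn(2)] e[symmetric] by simp
      then have "walk_state n ps ((n - v + (n - card (insert cur K))) * (length qs + 1) + (length qs - 0))
          (run walk_step s)"
        unfolding walk_state_def s
        using run_walk_step(3)[where M = M, OF regs M out(1), of ?w] out(2) Mj stores_mark[OF mem cur]
        by (intro exI[of _ qs] exI[of _ "insert cur K"] exI[of _ v] exI[of _ ?w]
            exI[of _ "2 + 2 * j"] exI[of _ 0]) simp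
      with less show ?thesis by blast
    next
      case in'
      let ?w = "fst (qs ! j)" and ?qs = "qs[j := (cur, fst (qs ! j))]"
      have e: "qs ! j = (?w, cur)" using in' by (cases "qs ! j") auto
      have "walk_inv n ps ?qs (insert cur K) v ?w (2 + 2 * j) 0"
        using walk_inv_take[OF inv v False jl in'(1) disjI2[OF e] qn(1)] .
      then have "walk_state n ps ((n - v + (n - card (insert cur K))) * (length qs + 1) + (length qs - 0))
          (run walk_step s)"
        unfolding walk_state_def s
        using run_walk_step(4)[where M = M, OF regs M in'(1), of ?w] in' Mj
          stores_mark[OF stores_update[OF mem jl] cur, of cur ?w]
        by (intro exI[of _ ?qs] exI[of _ "insert cur K"] exI[of _ v] exI[of _ ?w]
            exI[of _ "2 + 2 * j"] exI[of _ 0]) simp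
      with less show ?thesis by blast
    qed
  qed
qed


section \<open>Correctness of the output and counting loops\<close>

definition emit_inv :: "(nat \<Rightarrow> nat) \<Rightarrow> nat \<Rightarrow> (nat \<times> nat) list \<Rightarrow> nat \<Rightarrow> bool" where
  "emit_inv M n qs j \<longleftrightarrow>
    (\<forall>i<j. M (2 + 2 * i) = fst (qs ! i) \<and> M (3 + 2 * i) = snd (qs ! i)) \<and>
    (\<forall>i. j \<le> i \<and> i < length qs \<longrightarrow>
      M (4 * i) = fst (qs ! i) \<and> M (4 * i + 1) = n + i \<and>
      M (4 * i + 2) = snd (qs ! i) \<and> M (4 * i + 3) = n + i \<and>
      M (4 * length qs + 4 * i) = n + i \<and> M (4 * length qs + 4 * i + 1) = fst (qs ! i) \<and>
      M (4 * length qs + 4 * i + 2) = snd (qs ! i) \<and> M (4 * length qs + 4 * i + 3) = n + i)"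

text \<open>The output overwrites the input, but going downwards it never reaches an unread edge.\<close>

lemma emit_inv_step:
  assumes inv: "emit_inv M n qs (Suc j)" and j: "j < length qs"
    and ab: "qs ! j = (a, b)" and m: "m = length qs"
  shows "emit_inv (M(4 * j := a, 4 * j + 1 := n + j, 4 * j + 2 := b, 4 * j + 3 := n + j,
    4 * m + 4 * j := n + j, 4 * m + 4 * j + 1 := a, 4 * m + 4 * j + 2 := b,
    4 * m + 4 * j + 3 := n + j)) n qs j" (is "emit_inv ?M n qs j")
  unfolding emit_inv_def
proof (intro conjI allI impI)
  fix i assume "i < j"
  \<comment> \<open>An index \<open>i < j\<close> forces \<open>j \<ge> 1\<close>, so
    \<open>3 + 2 * i \<le> 2 * j + 1 < 4 * j\<close>: the unread edges lie below the new
    output.\<close>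
  moreover have "?M x = M x" if "x < 4 * j" for x using that by auto
  ultimately show "?M (2 + 2 * i) = fst (qs ! i)" "?M (3 + 2 * i) = snd (qs ! i)"
    using inv by (simp_all add: emit_inv_def)
next
  fix i assume i: "j \<le> i \<and> i < length qs"
  have keep: "?M x = M x" if "4 * j + 4 \<le> x \<and> x < 4 * m \<or> 4 * m + 4 * j + 4 \<le> x" for x
    using that by auto
  consider "i = j" | "Suc j \<le> i" using i by linarith
  then have "?M (4 * i) = fst (qs ! i) \<and> ?M (4 * i + 1) = n + i \<and>
      ?M (4 * i + 2) = snd (qs ! i) \<and> ?M (4 * i + 3) = n + i \<and>
      ?M (4 * m + 4 * i) = n + i \<and> ?M (4 * m + 4 * i + 1) = fst (qs ! i) \<and>
      ?M (4 * m + 4 * i + 2) = snd (qs ! i) \<and> ?M (4 * m + 4 * i + 3) = n + i"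
  proof cases
    case 1
    moreover have "qs \<noteq> []" using j by auto
    ultimately show ?thesis using ab m by simp
  next
    case 2
    have "4 * j + 4 \<le> 4 * i" "4 * i + 3 < 4 * m" using 2 i m by auto
    then show ?thesis using inv 2 i m by (simp only: keep) (simp add: emit_inv_def)
  qed
  then show "?M (4 * i) = fst (qs ! i)" "?M (4 * i + 1) = n + i"
    "?M (4 * i + 2) = snd (qs ! i)" "?M (4 * i + 3) = n + i"
    "?M (4 * length qs + 4 * i) = n + i" "?M (4 * length qs + 4 * i + 1) = fst (qs ! i)"
    "?M (4 * length qs + 4 * i + 2) = snd (qs ! i)" "?M (4 * length qs + 4 * i + 3) = n + i"
    unfolding m by blast+
qed

definition emit_state :: "nat \<Rightarrow> (nat \<times> nat) list \<Rightarrow> nat \<Rightarrow> ram_state \<Rightarrow> bool" where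
  "emit_state n qs j s \<longleftrightarrow> j \<le> length qs \<and> fst s 2 = n + j \<and> fst s 3 = 4 * length qs \<and>
    fst s 5 = 2 * j \<and> fst s 6 = 1 \<and> fst s 7 = 2 \<and> emit_inv (snd s) n qs j"

lemma emit_state_step:
  assumes st: "emit_state n qs b s" and guard: "fst s 5 \<noteq> 0"
  shows "\<exists>b'<b. emit_state n qs b' (run emit_step s)"
proof -
  obtain R M where s: "s = (R, M)" by (cases s)
  from st guard obtain j where j: "b = Suc j" by (cases b) (auto simp: emit_state_def)
  obtain x y where xy: "qs ! j = (x, y)" by (cases "qs ! j")
  have R: "R 2 = Suc (n + j)" "R 3 = 4 * length qs" "R 5 = 2 + 2 * j" "R 6 = 1" "R 7 = 2"
    and inv: "emit_inv M n qs (Suc j)" and jl: "j < length qs"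
    using st by (auto simp: emit_state_def s j)
  have M: "M (2 + 2 * j) = x" "M (3 + 2 * j) = y" using inv xy by (auto simp: emit_inv_def)
  have "snd (run emit_step s) = M(4 * j := x, 4 * j + 1 := n + j, 4 * j + 2 := y, 4 * j + 3 := n + j,
    4 * length qs + 4 * j := n + j, 4 * length qs + 4 * j + 1 := x, 4 * length qs + 4 * j + 2 := y,
    4 * length qs + 4 * j + 3 := n + j)"
    using R M by (simp add: s emit_step_def add_ac numeral_3_eq_3)
  then have "emit_inv (snd (run emit_step s)) n qs j"
    using emit_inv_step[OF inv jl xy refl] by simp
  moreover have "fst (run emit_step s) 2 = n + j" "fst (run emit_step s) 3 = 4 * length qs"
    "fst (run emit_step s) 5 = 2 * j" "fst (run emit_step s) 6 = 1" "fst (run emit_step s) 7 = 2"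
    using R by (simp_all add: s emit_step_def)
  ultimately have "emit_state n qs j (run emit_step s)"
    using jl by (simp add: emit_state_def)
  then show ?thesis using j by blast
qed

definition count_state :: "nat \<Rightarrow> nat \<Rightarrow> (nat \<Rightarrow> nat) \<Rightarrow> nat \<Rightarrow> ram_state \<Rightarrow> bool" where
  "count_state n m M i s \<longleftrightarrow> fst s 2 + i = n + m \<and> fst s 3 = 4 * m \<and> fst s 5 = 2 * m \<and>
    fst s 6 = 1 \<and> fst s 7 = 2 \<and> fst s 10 = 2 * i \<and> snd s = M"

lemma count_state_step:
  assumes "count_state n m M b s" "fst s 10 \<noteq> 0"
  shows "\<exists>b'<b. count_state n m M b' (run count_step s)"
proof -
  obtain i where i: "b = Suc i" using assms by (cases b) (auto simp: count_state_def)
  have "count_state n m M i (run count_step s)"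
    using assms unfolding i count_state_def count_step_def by simp
  then show ?thesis using i by blast
qed

section \<open>Arc lists read off from the final memory\<close>

definition inward_arcs :: "nat \<Rightarrow> (nat \<times> nat) list \<Rightarrow> (nat \<times> nat) list" where
  "inward_arcs n qs =
    concat (map (\<lambda>i. [(fst (qs ! i), n + i), (snd (qs ! i), n + i)]) [0..<length qs])"

definition through_arcs :: "nat \<Rightarrow> (nat \<times> nat) list \<Rightarrow> (nat \<times> nat) list" where
  "through_arcs n qs =
    concat (map (\<lambda>i. [(n + i, fst (qs ! i)), (snd (qs ! i), n + i)]) [0..<length qs])"

lemma map_upt_mult4:
  "map f [0..<4 * m] =
    concat (map (\<lambda>i. [f (4 * i), f (4 * i + 1), f (4 * i + 2), f (4 * i + 3)]) [0..<m])"
proof (induction m)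
  case (Suc m)
  have "[0..<4 * m + 4] = [0..<4 * m] @ [4 * m..<4 * m + 4]"
    by (rule upt_add_eq_append) simp
  also have "[4 * m..<4 * m + 4] = [4 * m, 4 * m + 1, 4 * m + 2, 4 * m + 3]"
    by (simp add: upt_rec)
  finally show ?case using Suc by (simp add: add.commute)
qed simp

lemma flatten_concat: "flatten (concat xss) = concat (map flatten xss)"
  by (induction xss) (auto simp: flatten_def)

lemma emit_inv_output:
  assumes inv: "emit_inv M n qs 0"
  shows "map M [0..<8 * length qs] = encode_arc_lists (inward_arcs n qs) (through_arcs n qs)"
proof -
  let ?m = "length qs"
  have "map M [0..<8 * ?m] = map M ([0..<4 * ?m] @ [4 * ?m..<4 * ?m + 4 * ?m])"
    by (subst upt_add_eq_append[symmetric]) auto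
  also have "\<dots> = map M [0..<4 * ?m] @ map (\<lambda>i. M (4 * ?m + i)) [0..<4 * ?m]"
    unfolding map_append map_add_upt[of "4 * ?m" "4 * ?m", symmetric] map_map
    by (simp add: o_def add.commute)
  also have "map M [0..<4 * ?m] = flatten (inward_arcs n qs)"
    using inv unfolding map_upt_mult4 inward_arcs_def flatten_concat map_map
    by (intro arg_cong[of _ _ concat] map_cong) (auto simp: emit_inv_def flatten_def)
  also have "map (\<lambda>i. M (4 * ?m + i)) [0..<4 * ?m] = flatten (through_arcs n qs)"
    using inv unfolding map_upt_mult4 through_arcs_def flatten_concat map_map
    by (intro arg_cong[of _ _ concat] map_cong) (auto simp: emit_inv_def flatten_def add.assoc)
  finally show ?thesis by (simp add: encode_arc_lists_def)
qed

section \<open>Correctness and running time of the whole program\<close>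

lemma length_flatten: "length (flatten ps) = 2 * length ps"
  by (induction ps) (auto simp: flatten_def)

lemma nth_flatten:
  "i < length ps \<Longrightarrow> flatten ps ! (2 * i) = fst (ps ! i) \<and> flatten ps ! (2 * i + 1) = snd (ps ! i)"
proof (induction ps arbitrary: i)
  case (Cons p ps)
  then show ?case by (cases i; cases p) (auto simp: flatten_def)
qed simp

lemma walk_state_init:
  "walk_state n ps (2 * n * (length ps + 1) + length ps)
    (run walk_init (ram_input (n # k # flatten ps)))"
proof -
  have M: "snd (ram_input (n # k # flatten ps)) (2 + 2 * i) = fst (ps ! i)"
    "snd (ram_input (n # k # flatten ps)) (3 + 2 * i) = snd (ps ! i)" if "i < length ps" for i
    using that nth_flatten[OF that] by (auto simp: ram_input_def length_flatten numeral_3_eq_3)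
  \<comment> \<open>Memory behind the input is 0, so no vertex is marked initially.\<close>
  have "stores (snd (ram_input (n # k # flatten ps))) n ps {}"
    unfolding stores_def using M by (auto simp: ram_input_def length_flatten)
  moreover have "snd (run walk_init (ram_input (n # k # flatten ps))) = snd (ram_input (n # k # flatten ps))"
    by (simp add: walk_init_def)
  moreover have "walk_regs (length ps) n 0 0 0 0 (fst (run walk_init (ram_input (n # k # flatten ps))))"
    by (simp add: walk_regs_def walk_init_def ram_input_def length_flatten)
  moreover have "walk_inv n ps ps {} 0 0 0 0"
    by (simp add: walk_inv_def owns_edges_def reorients_def list_all2_refl)
  ultimately show ?thesis
    unfolding walk_state_def
    by (intro exI[of _ ps] exI[of _ "{}"] exI[of _ 0]) simp
qed

lemma orient_program_correct:
  assumes deg: "min_degree_two n ps" and bd: "\<forall>(a, b)\<in>set ps. a < n \<and> b < n"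
  shows "\<exists>qs. reorients ps qs \<and> (\<forall>u<n. \<exists>i<length qs. fst (qs ! i) = u) \<and>
    computes_within orient_program (n # k # flatten ps) (200 * (2 * length ps + 2) ^ 2)
      (encode_arc_lists (inward_arcs n qs) (through_arcs n qs))"
proof -
  let ?m = "length ps"
  let ?s0 = "ram_input (n # k # flatten ps)"
  let ?b = "2 * n * (?m + 1) + ?m"
  have lf: "loop_free walk_init" "loop_free walk_step" "loop_free count_init" "loop_free count_step"
    "loop_free emit_step" "loop_free (Add 0 3 3)"
    by (simp_all add: walk_init_def walk_step_def count_init_def count_step_def emit_step_def)
  note e1 = exec_within_run[OF lf(1), of ?s0]
  obtain b1 s1 where e2: "exec_within (WhileNZ 10 walk_step) (run walk_init ?s0)
      (?b * (cost walk_step + 1) + 1) s1" and s1: "walk_state n ps b1 s1" "fst s1 10 = 0"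
    using exec_within_While[where I = "walk_state n ps", OF lf(2) walk_state_init, of 10] walk_state_step[OF deg bd] by blast
  from s1 obtain qs K v cur lp j where inv: "walk_inv n ps qs K v cur lp j"
    and regs: "walk_regs (length qs) n v cur lp j (fst s1)" and mem: "stores (snd s1) n qs K"
    unfolding walk_state_def by blast
  have re: "reorients ps qs" and "v = n"
    using inv regs s1(2) by (auto simp: walk_inv_def walk_regs_def)
  then have own: "\<forall>u<n. \<exists>i<length qs. fst (qs ! i) = u"
    using walk_inv_end inv by blast
  note len = reorients_length[OF re]
  note e3 = exec_within_run[OF lf(3), of s1]
  have "count_state n ?m (snd s1) ?m (run count_init s1)"
    using regs len by (simp add: count_state_def count_init_def walk_regs_def)
  then obtain b2 s2 where e4: "exec_within (WhileNZ 10 count_step) (run count_init s1)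
      (?m * (cost count_step + 1) + 1) s2" and s2: "count_state n ?m (snd s1) b2 s2" "fst s2 10 = 0"
    using exec_within_While[OF lf(4), of "count_state n ?m (snd s1)" ?m _ 10] count_state_step by blast
  have "emit_inv (snd s2) n qs (length qs)"
    using mem s2(1) by (simp add: emit_inv_def stores_def count_state_def)
  then have "emit_state n qs ?m s2"
    using s2 len by (auto simp: emit_state_def count_state_def)
  then obtain b3 s3 where e5: "exec_within (WhileNZ 5 emit_step) s2
      (?m * (cost emit_step + 1) + 1) s3" and s3: "emit_state n qs b3 s3" "fst s3 5 = 0"
    using exec_within_While[OF lf(5), of "emit_state n qs" ?m s2 5] emit_state_step by blast
  note e6 = exec_within_run[OF lf(6), of s3]
  let ?T = "cost walk_init + ((?b * (cost walk_step + 1) + 1) + (cost count_init +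
    ((?m * (cost count_step + 1) + 1) + ((?m * (cost emit_step + 1) + 1) + cost (Add 0 3 3)))))"
  have ex: "exec_within orient_program ?s0 ?T (run (Add 0 3 3) s3)"
    unfolding orient_program_def by (intro exec_within_Seq[OF e1] exec_within_Seq[OF e2]
      exec_within_Seq[OF e3] exec_within_Seq[OF e4] exec_within_Seq[OF e5] e6)
  have "b3 = 0" using s3 by (auto simp: emit_state_def)
  \<comment> \<open>Register 3 holds \<open>4 * ?m\<close>, so the final doubling gives the output
    length, eight words per edge.\<close>
  then have out: "ram_output (run (Add 0 3 3) s3) = encode_arc_lists (inward_arcs n qs) (through_arcs n qs)"
    using s3(1) emit_inv_output[of "snd s3" n qs]
    by (simp add: ram_output_def emit_state_def mult.commute)
  \<comment> \<open>Every vertex is the first end of some edge, so there are at least as many edges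
    as vertices, and the time is bounded by the number of edges alone.\<close>
  have "{..<n} \<subseteq> (\<lambda>i. fst (qs ! i)) ` {..<?m}" using own len by auto
  then have "n \<le> ?m" using surj_card_le[of "{..<?m}"] by fastforce
  \<comment> \<open>40 bounds a round of the walk with its test, 30 a counting and an output round
    together.\<close>
  have "?T \<le> 40 * ?b + (30 * ?m + 40)"
    by (simp add: walk_init_def walk_step_def count_init_def count_step_def emit_step_def)
  also have "\<dots> \<le> 40 * (2 * ?m * (?m + 1) + ?m) + (30 * ?m + 40)"
    using \<open>n \<le> ?m\<close> by (intro add_right_mono mult_left_mono mult_right_mono) auto
  also have "\<dots> \<le> 200 * (2 * ?m + 2) ^ 2" by (simp add: power2_eq_square algebra_simps)
  finally have "computes_within orient_program (n # k # flatten ps) (200 * (2 * ?m + 2) ^ 2)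
      (encode_arc_lists (inward_arcs n qs) (through_arcs n qs))"
    using ex out unfolding computes_within_def exec_within_def by (meson order_trans)
  with re own show ?thesis by blast
qed


section \<open>The orientations written by the program\<close>

lemma distinct_concat_map:
  assumes "distinct xs" "\<And>x. x \<in> set xs \<Longrightarrow> distinct (f x)"
    "\<And>x y. x \<in> set xs \<Longrightarrow> y \<in> set xs \<Longrightarrow> x \<noteq> y \<Longrightarrow> set (f x) \<inter> set (f y) = {}"
  shows "distinct (concat (map f xs))"
  using assms
proof (induction xs)
  case (Cons x xs)
  have "set (f x) \<inter> set (f y) = {}" if "y \<in> set xs" for y
    using Cons.prems(1) Cons.prems(3)[of x y] that by auto
  then have "set (f x) \<inter> set (concat (map f xs)) = {}" by auto
  moreover have "distinct (concat (map f xs))"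
    using Cons.prems by (intro Cons.IH) auto
  ultimately show ?case using Cons.prems(2) by simp
qed simp

lemma represents_inward_through:
  fixes G :: "'a graph"
  assumes G: "simple_graph G" and rep: "represents_graph vs ps G" and re: "reorients ps qs"
    and own: "\<forall>u<length vs. \<exists>i<length qs. fst (qs ! i) = u"
  obtains t where "\<forall>e\<in>edges G. t e \<in> e" "verts G \<subseteq> t ` edges G"
    "represents_arcs (subdivision_vertex_list vs ps) (inward_arcs (length vs) qs) (inward G)"
    "represents_arcs (subdivision_vertex_list vs ps) (through_arcs (length vs) qs) (through G t)"
proof -
  let ?n = "length vs" and ?m = "length qs" and ?W = "subdivision_vertex_list vs ps"
  define a b where "a i = fst (qs ! i)" and "b i = snd (qs ! i)" for i
  define E where "E i = edge_list vs ps ! i" for i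
  note len = reorients_length[OF re]
  have E: "E i = {vs ! a i, vs ! b i}" if "i < ?m" for i
    using that len reorients_nth[OF re, of i]
    by (cases "ps ! i") (auto simp: E_def edge_list_def a_def b_def)
  have bd: "a i < ?n" "b i < ?n" if "i < ?m" for i
  proof -
    have "ps ! i \<in> set ps" using that len by simp
    then have "fst (ps ! i) < ?n \<and> snd (ps ! i) < ?n"
      using rep by (auto simp: represents_graph_def split_beta)
    then show "a i < ?n" "b i < ?n"
      using reorients_nth[OF re, of i] that len by (auto simp: a_def b_def)
  qed
  have lenE: "length (edge_list vs ps) = ?m" using len by (simp add: edge_list_def)
  have "set (edge_list vs ps) = E ` {..<?m}" unfolding set_conv_nth lenE E_def by auto
  then have edges: "edges G = E ` {..<?m}" using rep by (simp add: represents_graph_def)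
  have inj: "inj_on E {..<?m}"
    using rep unfolding represents_graph_def distinct_conv_nth[of "edge_list vs ps"] lenE E_def
    by (auto simp: inj_on_def)
  have ne: "vs ! a i \<noteq> vs ! b i" if "i < ?m" for i
  proof -
    have "E i \<in> edges G" using edges that by blast
    then have "card (E i) = 2" using G by (simp add: simple_graph_def)
    then show ?thesis using E[OF that] by auto
  qed
  then have ne': "a i \<noteq> b i" if "i < ?m" for i using that by metis
  \<comment> \<open>The edges are listed once each, so \<open>E\<close> is injective and the first
    end in \<open>qs\<close> depends on the edge alone.\<close>
  define t where "t e = vs ! a (inv_into {..<?m} E e)" for e
  have t: "t (E i) = vs ! a i" if "i < ?m" for i
    using inv_into_f_f[OF inj] that by (simp add: t_def)
  have W: "?W ! x = Inl (vs ! x)" if "x < ?n" for x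
    using that by (simp add: subdivision_vertex_list_def nth_append)
  have W': "?W ! (?n + i) = Inr (E i)" if "i < ?m" for i
    using that len by (simp add: subdivision_vertex_list_def nth_append E_def edge_list_def)
  have lenW: "length ?W = ?n + ?m"
    using len by (simp add: subdivision_vertex_list_def edge_list_def)
  show ?thesis
  proof
    show "\<forall>e\<in>edges G. t e \<in> e" using edges E t by auto
    show "verts G \<subseteq> t ` edges G"
    proof
      fix v assume "v \<in> verts G"
      then have "v \<in> set vs" using rep by (simp add: represents_graph_def)
      then obtain u where "u < ?n" "v = vs ! u" by (auto simp: in_set_conv_nth)
      moreover then obtain i where "i < ?m" "a i = u" using own by (auto simp: a_def)
      ultimately show "v \<in> t ` edges G" using t edges by (intro image_eqI[of _ _ "E i"]) auto
    qed
    \<comment> \<open>Arcs of different edges differ in the subdividing vertex. The two arcs of one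
      edge differ because of \<open>a i \<noteq> b i\<close> in the first list and
      \<open>b i < ?n\<close> in the second.\<close>
    have dist: "distinct (inward_arcs ?n qs)" "distinct (through_arcs ?n qs)"
      unfolding inward_arcs_def through_arcs_def
      by (intro distinct_concat_map; use ne' bd in \<open>fastforce simp: a_def b_def\<close>)+
    have bounds: "\<forall>(i, j)\<in>set (inward_arcs ?n qs). i < length ?W \<and> j < length ?W"
      "\<forall>(i, j)\<in>set (through_arcs ?n qs). i < length ?W \<and> j < length ?W"
      using bd by (auto simp: inward_arcs_def through_arcs_def lenW a_def b_def intro: trans_less_add1)
    have image: "(\<lambda>(i, j). (?W ! i, ?W ! j)) ` set (inward_arcs ?n qs) =
        (\<Union>i<?m. {(?W ! a i, ?W ! (?n + i)), (?W ! b i, ?W ! (?n + i))})"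
      "(\<lambda>(i, j). (?W ! i, ?W ! j)) ` set (through_arcs ?n qs) =
        (\<Union>i<?m. {(?W ! (?n + i), ?W ! a i), (?W ! b i, ?W ! (?n + i))})"
      by (simp_all add: inward_arcs_def through_arcs_def image_UN a_def b_def lessThan_atLeast0)
    have inward: "(\<Union>i<?m. {(?W ! a i, ?W ! (?n + i)), (?W ! b i, ?W ! (?n + i))}) = inward G"
    proof -
      have "inward G = (\<Union>e\<in>edges G. (\<lambda>v. (Inl v, Inr e)) ` e)"
        unfolding inward_def by auto
      then show ?thesis using bd by (simp add: edges W W' E)
    qed
    have through: "(\<Union>i<?m. {(?W ! (?n + i), ?W ! a i), (?W ! b i, ?W ! (?n + i))}) = through G t"
    proof -
      have "through G t =
          (\<Union>e\<in>edges G. insert (Inr e, Inl (t e)) ((\<lambda>v. (Inl v, Inr e)) ` (e - {t e})))"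
        unfolding through_def by auto
      also have "\<dots> = (\<Union>i<?m. insert (Inr (E i), Inl (t (E i)))
          ((\<lambda>v. (Inl v, Inr (E i))) ` (E i - {t (E i)})))"
        by (simp add: edges)
      also have "\<dots> = (\<Union>i<?m. {(?W ! (?n + i), ?W ! a i), (?W ! b i, ?W ! (?n + i))})"
      proof (rule SUP_cong)
        fix i assume "i \<in> {..<?m}"
        then have i: "i < ?m" by simp
        have "E i - {t (E i)} = {vs ! b i}" using E[OF i] t[OF i] ne[OF i] by auto
        then show "insert (Inr (E i), Inl (t (E i))) ((\<lambda>v. (Inl v, Inr (E i))) ` (E i - {t (E i)})) =
            {(?W ! (?n + i), ?W ! a i), (?W ! b i, ?W ! (?n + i))}"
          using i by (simp add: W W' bd t)
      qed simp
      finally show ?thesis by simp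
    qed
    show "represents_arcs ?W (inward_arcs ?n qs) (inward G)"
      unfolding represents_arcs_def image inward using dist bounds by simp
    show "represents_arcs ?W (through_arcs ?n qs) (through G t)"
      unfolding represents_arcs_def image through using dist bounds by simp
  qed
qed

lemma min_degree_two_of_representation:
  assumes rep: "represents_graph vs ps G" and deg: "2 \<le> min_degree G"
  shows "min_degree_two (length vs) ps"
  unfolding min_degree_two_def
proof (intro allI impI)
  fix u l assume u: "u < length vs"
  let ?S = "{e \<in> edges G. vs ! u \<in> e}"
  have "vs ! u \<in> verts G" using rep u by (auto simp: represents_graph_def)
  then have "min_degree G \<le> enat (vdegree G (vs ! u))"
    unfolding min_degree_def by (rule INF_lower)
  with deg have "enat 2 \<le> enat (card ?S)"
    unfolding vdegree_def numeral_eq_enat by (rule order_trans)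
  \<comment> \<open>Two edges at a vertex cannot both be the \<open>l\<close>-th one. For
    \<open>l\<close> beyond the list, \<open>edge_list vs ps ! l\<close> is an unspecified set, to
    which the same argument applies.\<close>
  then have "\<not> card ?S \<le> card {edge_list vs ps ! l}" by simp
  then have "\<not> ?S \<subseteq> {edge_list vs ps ! l}" using card_mono[of "{edge_list vs ps ! l}" ?S] by blast
  then obtain e where e: "e \<in> edges G" "vs ! u \<in> e" "e \<noteq> edge_list vs ps ! l" by blast
  have "e \<in> set (edge_list vs ps)" using rep e(1) by (simp add: represents_graph_def)
  then obtain i where i: "i < length ps" "e = edge_list vs ps ! i"
    by (auto simp: in_set_conv_nth edge_list_def)
  have "ps ! i \<in> set ps" using i(1) by simp
  then have "fst (ps ! i) < length vs" "snd (ps ! i) < length vs"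
    using rep by (auto simp: represents_graph_def split_beta)
  moreover have "vs ! u = vs ! fst (ps ! i) \<or> vs ! u = vs ! snd (ps ! i)"
    using e(2) i by (auto simp: edge_list_def split_beta)
  ultimately have "u = fst (ps ! i) \<or> u = snd (ps ! i)"
    using rep u by (auto simp: represents_graph_def nth_eq_iff_index_eq)
  then show "\<exists>i<length ps. i \<noteq> l \<and> (u = fst (ps ! i) \<or> u = snd (ps ! i))"
    using i e(3) by blast
qed

lemma length_le_bit_size: "length xs \<le> bit_size xs"
  unfolding bit_size_def by (induction xs) auto

theorem theorem9p4:
  "\<exists>(c :: com) (p :: nat poly).
    \<forall>(G :: 'a graph) (k :: nat) vs ps.
      simple_graph G \<longrightarrow> 2 \<le> min_degree G \<longrightarrow> 2 \<le> k \<longrightarrow> represents_graph vs ps G \<longrightarrow>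
      (\<exists>O1 O2 qs1 qs2.
        orientation (subdivision G) O1 \<and> orientation (subdivision G) O2 \<and>
        represents_arcs (subdivision_vertex_list vs ps) qs1 O1 \<and>
        represents_arcs (subdivision_vertex_list vs ps) qs2 O2 \<and>
        computes_within c (encode_instance vs ps k)
          (poly p (bit_size (encode_instance vs ps k))) (encode_arc_lists qs1 qs2) \<and>
        (graph_dist (inversion_graph (subdivision G)) O1 O2 \<le> enat k \<longleftrightarrow>
         graph_diam (inversion_graph (subdivision G)) \<le> enat k) \<and>
        (graph_diam (inversion_graph (subdivision G)) \<le> enat k \<longleftrightarrow>
         chromatic_number G \<le> 2 ^ k - 1))"
proof (intro exI[of _ orient_program] exI[of _ "monom 200 2"] allI impI)
  fix G :: "'a graph" and k :: nat and vs ps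
  assume G: "simple_graph G" and deg: "2 \<le> min_degree G" and rep: "represents_graph vs ps G"
  let ?I = "encode_instance vs ps k"
  have "\<forall>(i, j)\<in>set ps. i < length vs \<and> j < length vs"
    using rep by (simp add: represents_graph_def)
  from orient_program_correct[OF min_degree_two_of_representation[OF rep deg] this, of k]
  obtain qs where re: "reorients ps qs" and own: "\<forall>u<length vs. \<exists>i<length qs. fst (qs ! i) = u"
    and comp: "computes_within orient_program ?I (200 * (2 * length ps + 2) ^ 2)
      (encode_arc_lists (inward_arcs (length vs) qs) (through_arcs (length vs) qs))"
    unfolding encode_instance_def by blast
  \<comment> \<open>The input has \<open>2 * length ps + 2\<close> entries, and the separator alone
    makes each contribute at least 1 to the bit size.\<close>
  have "2 * length ps + 2 \<le> bit_size ?I"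
    using length_le_bit_size[of ?I] by (simp add: encode_instance_def length_flatten)
  then have "200 * (2 * length ps + 2) ^ 2 \<le> poly (monom 200 2) (bit_size ?I)"
    by (simp add: poly_monom power_mono)
  with comp have comp: "computes_within orient_program ?I (poly (monom 200 2) (bit_size ?I))
      (encode_arc_lists (inward_arcs (length vs) qs) (through_arcs (length vs) qs))"
    unfolding computes_within_def by (meson order_trans)
  obtain t where t: "\<forall>e\<in>edges G. t e \<in> e" "verts G \<subseteq> t ` edges G"
    and arcs: "represents_arcs (subdivision_vertex_list vs ps) (inward_arcs (length vs) qs) (inward G)"
      "represents_arcs (subdivision_vertex_list vs ps) (through_arcs (length vs) qs) (through G t)"
    by (rule represents_inward_through[OF G rep re own])
  show "\<exists>O1 O2 qs1 qs2.
        orientation (subdivision G) O1 \<and> orientation (subdivision G) O2 \<and>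
        represents_arcs (subdivision_vertex_list vs ps) qs1 O1 \<and>
        represents_arcs (subdivision_vertex_list vs ps) qs2 O2 \<and>
        computes_within orient_program ?I
          (poly (monom 200 2) (bit_size ?I)) (encode_arc_lists qs1 qs2) \<and>
        (graph_dist (inversion_graph (subdivision G)) O1 O2 \<le> enat k \<longleftrightarrow>
         graph_diam (inversion_graph (subdivision G)) \<le> enat k) \<and>
        (graph_diam (inversion_graph (subdivision G)) \<le> enat k \<longleftrightarrow>
         chromatic_number G \<le> 2 ^ k - 1)"
    using orientation_inward orientation_through[OF t(1)] arcs comp inversion_equivalences[OF G t]
    by blast
qed

end
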